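(* There is a function $f \in \mathcal{B}_{\mathbb{D}}$ (the Eremenko-Lyubich class for the disc) such that $f \notin \mathcal{A}$ (the MacLane class).
   Context: $\mathbb{D}=\{z\in\mathbb{C}:|z|<1\}$ and $\widehat{\mathbb{C}}=\mathbb{C}\cup\{\infty\}$. A boundary path is a path $\Gamma:[0,1)\to\mathbb{D}$ with $|\Gamma(t)|\to 1$ as $t\to 1$; its end is the set $\overline{\Gamma}\cap\partial\mathbb{D}$. A holomorphic function $f$ in $\mathbb{D}$ has asymptotic value $a\in\widehat{\mathbb{C}}$ if there is a boundary path $\Gamma$ with $f(\Gamma(t))\to a$ as $t\to1$; if moreover the end of $\Gamma$ is a singleton $\{\zeta\}$, then $f$ has asymptotic value $a$ at $\zeta$. The MacLane class $\mathcal{A}$ is the set of functions holomorphic and non-constant in $\mathbb{D}$ that have asymptotic values (in $\widehat{\mathbb{C}}$) at points of a dense subset of $\partial\mathbb{D}$. $CV(f)=\{f(z): z\in\mathbb{D},\ f'(z)=0\}$, and $AV(f)$ is the set of finite asymptotic values of $f$. The class $\mathcal{B}_{\mathbb{D}}$ is the set of functions $f$ holomorphic and non-constant in $\mathbb{D}$ such that $CV(f)\cup AV(f)$ is bounded. *)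

theory Defs
  imports "HOL-Analysis.Analysis"
begin

abbreviation unit_disc :: "complex set" where
  "unit_disc \<equiv> ball 0 1"

abbreviation unit_circle :: "complex set" where
  "unit_circle \<equiv> sphere 0 1"

text \<open>The one-point compactification of the complex plane: \<^term>\<open>Some a\<close> is the finite point
  \<^term>\<open>a\<close>, and \<^term>\<open>None\<close> is the point at infinity.\<close>

definition riemann_sphere :: "complex option topology" where
  "riemann_sphere = Alexandroff_compactification (euclidean :: complex topology)"

lemma limitin_riemann_sphere_Some:
  "limitin riemann_sphere (\<lambda>t. Some (g t)) (Some a) F \<longleftrightarrow> (g \<longlongrightarrow> a) F"
proof
  assume L: "limitin riemann_sphere (\<lambda>t. Some (g t)) (Some a) F"
  show "(g \<longlongrightarrow> a) F"
  proof (rule topological_tendstoI)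
    fix S assume "open S" "a \<in> S"
    then have "\<forall>\<^sub>F t in F. Some (g t) \<in> Some ` S"
      using limitinD[OF L, of "Some ` S"] by (auto simp: riemann_sphere_def)
    then show "\<forall>\<^sub>F t in F. g t \<in> S"
      by (rule eventually_mono) auto
  qed
next
  assume "(g \<longlongrightarrow> a) F"
  then have "limitin riemann_sphere (Some \<circ> g) (Some a) F"
    using continuous_map_limit[OF continuous_map_Some, of euclidean g a F]
    by (simp add: riemann_sphere_def)
  then show "limitin riemann_sphere (\<lambda>t. Some (g t)) (Some a) F"
    by (simp add: o_def)
qed

lemma limitin_riemann_sphere_None:
  "limitin riemann_sphere (\<lambda>t. Some (g t)) None F \<longleftrightarrow> filterlim g at_infinity F"
proof
  assume L: "limitin riemann_sphere (\<lambda>t. Some (g t)) None F"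
  show "filterlim g at_infinity F"
    unfolding filterlim_at_infinity[OF order_refl]
  proof (intro allI impI)
    fix r :: real assume "r > 0"
    have "openin riemann_sphere (insert None (Some ` (- cball 0 r)))"
      unfolding riemann_sphere_def openin_Alexandroff_compactification
      by (intro disjI2 exI[of _ "cball 0 r"]) (simp add: Compl_eq_Diff_UNIV)
    from limitinD[OF L this] have "\<forall>\<^sub>F t in F. Some (g t) \<in> insert None (Some ` (- cball 0 r))"
      by simp
    then show "\<forall>\<^sub>F t in F. r \<le> norm (g t)"
      by (rule eventually_mono) auto
  qed
next
  assume L: "filterlim g at_infinity F"
  show "limitin riemann_sphere (\<lambda>t. Some (g t)) None F"
    unfolding limitin_def
  proof (intro conjI allI impI)
    show "None \<in> topspace riemann_sphere"
      by (simp add: riemann_sphere_def)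
    fix U assume "openin riemann_sphere U \<and> None \<in> U"
    then obtain C where C: "compact C" "U = insert None (Some ` (- C))"
      by (auto simp: riemann_sphere_def openin_Alexandroff_compactification Compl_eq_Diff_UNIV)
    then obtain r where r: "r > 0" "\<forall>x\<in>C. norm x \<le> r"
      by (meson bounded_pos compact_imp_bounded)
    have "\<forall>\<^sub>F t in F. r + 1 \<le> norm (g t)"
      using L r unfolding filterlim_at_infinity[OF order_refl] by auto
    then show "\<forall>\<^sub>F t in F. Some (g t) \<in> U"
      by (rule eventually_mono) (use C r in fastforce)
  qed
qed

definition boundary_path :: "(real \<Rightarrow> complex) \<Rightarrow> bool" where
  "boundary_path \<Gamma> \<longleftrightarrow>
     continuous_on {0..<1} \<Gamma> \<and> \<Gamma> ` {0..<1} \<subseteq> unit_disc \<and>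
     ((\<lambda>t. norm (\<Gamma> t)) \<longlongrightarrow> 1) (at_left 1)"

definition path_end :: "(real \<Rightarrow> complex) \<Rightarrow> complex set" where
  "path_end \<Gamma> = closure (\<Gamma> ` {0..<1}) \<inter> unit_circle"

definition asymptotic_along :: "(complex \<Rightarrow> complex) \<Rightarrow> (real \<Rightarrow> complex) \<Rightarrow> complex option \<Rightarrow> bool" where
  "asymptotic_along f \<Gamma> a \<longleftrightarrow>
     boundary_path \<Gamma> \<and> limitin riemann_sphere (\<lambda>t. Some (f (\<Gamma> t))) a (at_left 1)"

definition asymptotic_value :: "(complex \<Rightarrow> complex) \<Rightarrow> complex option \<Rightarrow> bool" where
  "asymptotic_value f a \<longleftrightarrow> (\<exists>\<Gamma>. asymptotic_along f \<Gamma> a)"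

definition asymptotic_value_at :: "(complex \<Rightarrow> complex) \<Rightarrow> complex option \<Rightarrow> complex \<Rightarrow> bool" where
  "asymptotic_value_at f a \<zeta> \<longleftrightarrow> (\<exists>\<Gamma>. asymptotic_along f \<Gamma> a \<and> path_end \<Gamma> = {\<zeta>})"

definition critical_values :: "(complex \<Rightarrow> complex) \<Rightarrow> complex set" where
  "critical_values f = {f z | z. z \<in> unit_disc \<and> deriv f z = 0}"

definition finite_asymptotic_values :: "(complex \<Rightarrow> complex) \<Rightarrow> complex set" where
  "finite_asymptotic_values f = {a. asymptotic_value f (Some a)}"

text \<open>Functions on the disc are represented by total functions; both classes below depend only
  on the values taken on \<^term>\<open>unit_disc\<close>.\<close>

definition maclane_class :: "(complex \<Rightarrow> complex) set" where
  "maclane_class = {f. f holomorphic_on unit_disc \<and> \<not> f constant_on unit_disc \<and>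
     unit_circle \<subseteq> closure {\<zeta> \<in> unit_circle. \<exists>a. asymptotic_value_at f a \<zeta>}}"

definition eremenko_lyubich_disc :: "(complex \<Rightarrow> complex) set" where
  "eremenko_lyubich_disc = {f. f holomorphic_on unit_disc \<and> \<not> f constant_on unit_disc \<and>
     bounded (critical_values f \<union> finite_asymptotic_values f)}"

end

theory Submission
  imports Defs "HOL-Complex_Analysis.Complex_Analysis" "HOL-Real_Asymp.Real_Asymp"
begin

text \<open>
  The curve \<open>u \<mapsto> exp (\<i> ln u - 1 / sqrt u)\<close> spirals out to the whole unit circle, and its analytic
  continuation to a half strip of height \<open>8\<close> about the real axis is injective, because there the
  width of the image band is of order \<open>1 / u\<close> while consecutive turns are \<open>u powr (-1/2)\<close> apart, up to
  a constant factor.  On the horizontal lines at height between \<open>2 * pi / 3\<close> and \<open>pi\<close> the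
  function \<open>exp (exp s)\<close> decays doubly exponentially, so Cauchy integrals along their
  images produce a function \<open>f\<close>, holomorphic in the disc, that is bounded off the spiral band and
  differs from \<open>exp (exp s)\<close> by a bounded amount inside it.  Hence \<open>f\<close> is close to a logarithmic
  covering over a neighbourhood of infinity, which bounds its critical and finite asymptotic values.
  A path ending at a single boundary point crosses the spiral infinitely often, so its only possible
  asymptotic value is infinity; but then the path would have to stay in the spiral band and its end
  would be the whole circle.
\<close>

subsection \<open>The spiral band\<close>

text \<open>A Cauchy integral cannot be estimated by absolute values next to its own contour, and
  this obstacle fixes most constants. The contour may have any height between
  \<open>2 * pi / 3\<close> and \<open>pi\<close>, where the integrand decays; both extremes give
  the same function in the disc, so each point can be treated with the contour that is far from it.
  The dividing height \<open>5 * pi / 6\<close> is \<open>pi / 6 > 1/2\<close> away from both, which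
  is why discs of radius \<open>1/2\<close> in the parameter plane measure distance throughout. The
  half height \<open>4\<close> exceeds \<open>pi + 1/2\<close>, so such discs about contour points
  stay in the domain. Beyond abscissa \<open>10000\<close> the quantity
  \<open>1 / sqrt (norm s)\<close> is at most \<open>1/100\<close>, which makes every perturbation
  estimate work with simple rational constants. Parameter distance \<open>1/2\<close> becomes a
  distance of order \<open>1 / norm s\<close> in the disc, so the kernel loses a factor linear in
  \<open>norm s\<close>, and the doubly exponential decay pays for it.\<close>

definition half_strip :: "real \<Rightarrow> real \<Rightarrow> complex set" where
  "half_strip M A = {s. M < Re s \<and> \<bar>Im s\<bar> < A}"

abbreviation spiral_dom :: "complex set" where
  "spiral_dom \<equiv> half_strip 10000 4"

text \<open>In the coordinate \<open>l = Ln s\<close> this is the identity plus the small term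
  \<open>\<i> * exp (- l / 2)\<close>; the inverse square root is written through \<open>Ln\<close>
  so that estimates concern a perturbation of the identity. The real part is an unreduced angle of
  \<open>spiral s\<close>, the imaginary part is minus the logarithm of its modulus.\<close>

definition spiral_exponent :: "complex \<Rightarrow> complex" where
  "spiral_exponent s = Ln s + \<i> * exp (- Ln s / 2)"

definition spiral :: "complex \<Rightarrow> complex" where
  "spiral s = exp (\<i> * spiral_exponent s)"

lemma half_strip_eq: "half_strip M A = {s. M < Re s} \<inter> {s. - A < Im s} \<inter> {s. Im s < A}"
  by (auto simp: half_strip_def)

lemma open_half_strip: "open (half_strip M A)"
  unfolding half_strip_eq
  by (intro open_Int open_halfspace_Re_gt open_halfspace_Im_gt open_halfspace_Im_lt)

lemma convex_half_strip: "convex (half_strip M A)"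
  unfolding half_strip_eq
  by (intro convex_Int convex_halfspace_Re_gt convex_halfspace_Im_gt convex_halfspace_Im_lt)

lemma spiral_dom_nonzero: "s \<in> spiral_dom \<Longrightarrow> s \<noteq> 0"
  and spiral_dom_notin_nonpos: "s \<in> spiral_dom \<Longrightarrow> s \<notin> \<real>\<^sub>\<le>\<^sub>0"
  by (auto simp: half_strip_def complex_nonpos_Reals_iff)

lemma spiral_exponent_deriv:
  assumes "s \<in> spiral_dom"
  shows "(spiral_exponent has_field_derivative (1 - \<i> / 2 * exp (- Ln s / 2)) / s) (at s)"
  unfolding spiral_exponent_def
  using spiral_dom_nonzero[OF assms] spiral_dom_notin_nonpos[OF assms]
  by (auto intro!: derivative_eq_intros simp: field_simps)

lemma spiral_has_deriv:
  assumes "s \<in> spiral_dom"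
  shows "(spiral has_field_derivative spiral s * (\<i> * ((1 - \<i> / 2 * exp (- Ln s / 2)) / s))) (at s)"
  unfolding spiral_def
  by (rule derivative_eq_intros spiral_exponent_deriv[OF assms] refl)+ (simp add: spiral_def)

lemma spiral_holomorphic: "spiral holomorphic_on spiral_dom"
  using spiral_has_deriv by (meson field_differentiable_at_within field_differentiable_def holomorphic_onI)

lemma spiral_exponent_continuous: "continuous_on spiral_dom spiral_exponent"
  by (meson DERIV_continuous continuous_at_imp_continuous_on spiral_exponent_deriv)

section \<open>Modulus and injectivity of the spiral map\<close>

lemma exp_half_lipschitz:
  fixes l l' :: complex
  assumes "0 \<le> Re l" "0 \<le> Re l'"
  shows "norm (exp (- l / 2) - exp (- l' / 2)) \<le> norm (l - l') / 2"
proof -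
  have "norm ((\<lambda>l. exp (- l / 2)) l - (\<lambda>l. exp (- l / 2)) l') \<le> (1/2) * norm (l - l')"
  proof (rule field_differentiable_bound[where S = "{l. 0 \<le> Re l}"])
    show "convex {l. 0 \<le> Re l}"
      using convex_halfspace_Re_ge by simp
    fix x :: complex assume "x \<in> {l. 0 \<le> Re l}"
    then show "norm (- exp (- x / 2) / 2) \<le> 1 / 2"
      by (simp add: norm_divide)
    show "((\<lambda>l. exp (- l / 2)) has_field_derivative - exp (- x / 2) / 2) (at x within {l. 0 \<le> Re l})"
      by (auto intro!: derivative_eq_intros)
  qed (use assms in auto)
  then show ?thesis by simp
qed

lemma Re_Ln_nonneg: "1 \<le> norm s \<Longrightarrow> 0 \<le> Re (Ln s)"
  by (cases "s = 0") (auto)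

text \<open>The perturbing term has Lipschitz constant \<open>1/2\<close> on the right half plane,
  hence distances in the coordinate \<open>Ln s\<close> change by at most a factor of two. The
  condition \<open>1 \<le> norm s\<close> puts \<open>Ln s\<close> into that half plane.\<close>

lemma spiral_exponent_bilipschitz:
  assumes "1 \<le> norm s" "1 \<le> norm s'"
  shows "norm (Ln s - Ln s') / 2 \<le> norm (spiral_exponent s - spiral_exponent s')"
    and "norm (spiral_exponent s - spiral_exponent s') \<le> 2 * norm (Ln s - Ln s')"
proof -
  define e where "e = exp (- Ln s / 2) - exp (- Ln s' / 2)"
  have e: "norm e \<le> norm (Ln s - Ln s') / 2"
    unfolding e_def using assms by (intro exp_half_lipschitz Re_Ln_nonneg)
  have eq: "spiral_exponent s - spiral_exponent s' = (Ln s - Ln s') + \<i> * e"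
    by (simp add: spiral_exponent_def e_def algebra_simps)
  show "norm (Ln s - Ln s') / 2 \<le> norm (spiral_exponent s - spiral_exponent s')"
    using e norm_diff_triangle_ineq[of "Ln s - Ln s'" "\<i> * e" 0 "\<i> * e"]
      norm_triangle_ineq4[of "Ln s - Ln s' + \<i> * e" "\<i> * e"]
    unfolding eq by (simp add: norm_mult)
  show "norm (spiral_exponent s - spiral_exponent s') \<le> 2 * norm (Ln s - Ln s')"
    using e norm_triangle_ineq[of "Ln s - Ln s'" "\<i> * e"] norm_ge_zero[of "Ln s - Ln s'"]
    unfolding eq norm_mult norm_ii by linarith
qed

lemma norm_exp_half_Ln: "s \<noteq> 0 \<Longrightarrow> norm (exp (- Ln s / 2)) = 1 / sqrt (norm s)"
  by (simp add: exp_minus norm_inverse ln_sqrt[symmetric] norm_divide) (simp add: field_simps)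

lemma norm_ge_spiral_dom: "s \<in> spiral_dom \<Longrightarrow> 10000 < norm s"
  using complex_Re_le_cmod[of s] by (auto simp: half_strip_def)

lemma inverse_sqrt_norm_le: "s \<in> spiral_dom \<Longrightarrow> 1 / sqrt (norm s) \<le> 1/100"
  using norm_ge_spiral_dom[of s] real_le_rsqrt[of 100 "norm s"] by (simp add: divide_le_eq)

text \<open>\<open>Ln s\<close> is compared with the real number \<open>Ln (Re s)\<close>, at a cost
  of order \<open>1 / norm s\<close>. One of the two factors \<open>1 / sqrt (norm s)\<close> is
  then spent on the small constant \<open>5/100 = 1/20\<close>: the band is thin compared with the
  gap between turns.\<close>

lemma Im_Ln_bound:
  assumes "s \<in> spiral_dom"
  shows "\<bar>Im (Ln s)\<bar> \<le> 1/20 * (1 / sqrt (norm s))"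
proof -
  have n: "10000 < norm s" and u: "10000 < Re s" "\<bar>Im s\<bar> < 4"
    using assms norm_ge_spiral_dom by (auto simp: half_strip_def)
  have "norm (Ln s - Ln (of_real (Re s))) \<le> 1 / Re s * norm (s - of_real (Re s))"
  proof (rule field_differentiable_bound[where S = "{w. Re s \<le> Re w}"])
    show "convex {w. Re s \<le> Re w}"
      using convex_halfspace_Re_ge by simp
    fix x :: complex assume x: "x \<in> {w. Re s \<le> Re w}"
    then have "x \<notin> \<real>\<^sub>\<le>\<^sub>0" using u by (auto simp: complex_nonpos_Reals_iff)
    then show "(Ln has_field_derivative inverse x) (at x within {w. Re s \<le> Re w})"
      by (rule has_field_derivative_at_within[OF has_field_derivative_Ln])
    have "Re s \<le> norm x" using x complex_Re_le_cmod[of x] by simp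
    then show "norm (inverse x) \<le> 1 / Re s"
      using u le_imp_inverse_le[of "Re s" "norm x"] unfolding norm_inverse by (simp add: inverse_eq_divide)
  qed auto
  moreover have "norm (s - of_real (Re s)) = \<bar>Im s\<bar>"
    by (simp add: cmod_def)
  moreover have "\<bar>Im (Ln s)\<bar> \<le> norm (Ln s - Ln (of_real (Re s)))"
    using abs_Im_le_cmod[of "Ln s - Ln (of_real (Re s))"] u by (simp add: Ln_of_real)
  ultimately have a: "\<bar>Im (Ln s)\<bar> \<le> \<bar>Im s\<bar> / Re s" by simp
  have "norm s \<le> Re s + 4"
    using cmod_le[of s] u by simp
  then have b: "4 / Re s \<le> 5 / norm s"
    using u spiral_dom_nonzero[OF assms] by (simp add: field_simps)
  have c: "5 / norm s = 5 * (1 / sqrt (norm s)) * (1 / sqrt (norm s))"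
    using n by (simp add: field_simps)
  have "5 * (1 / sqrt (norm s)) * (1 / sqrt (norm s)) \<le> 5 * (1 / 100) * (1 / sqrt (norm s))"
    by (intro mult_right_mono mult_left_mono inverse_sqrt_norm_le[OF assms]) auto
  moreover have "\<bar>Im s\<bar> / Re s \<le> 4 / Re s"
    using u by (simp add: divide_right_mono)
  ultimately show ?thesis using a b unfolding c by linarith
qed

text \<open>With \<open>r = 1 / sqrt (norm s)\<close> the imaginary part is
  \<open>Im (Ln s) + r * cos (Im (Ln s) / 2)\<close>; the first term is at most
  \<open>r / 20\<close> in modulus and the cosine lies between \<open>9/10\<close> and
  \<open>1\<close>. The ratio of the two constants is below \<open>2\<close>, as injectivity
  requires.\<close>

lemma Im_spiral_exponent_bounds:
  assumes "s \<in> spiral_dom"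
  shows "4/5 * (1 / sqrt (norm s)) \<le> Im (spiral_exponent s)"
    and "Im (spiral_exponent s) \<le> 11/10 * (1 / sqrt (norm s))"
proof -
  define r where "r = 1 / sqrt (norm s)"
  have n: "norm s > 0" "s \<noteq> 0" using norm_ge_spiral_dom[OF assms] by auto
  have r: "0 < r" "r \<le> 1/100" using n inverse_sqrt_norm_le[OF assms] by (auto simp: r_def)
  have i: "\<bar>Im (Ln s)\<bar> \<le> 1/20 * r" using Im_Ln_bound[OF assms] by (simp add: r_def)
  have e: "Im (spiral_exponent s) = Im (Ln s) + r * cos (Im (Ln s) / 2)"
    using norm_exp_half_Ln[OF n(2)]
    by (simp add: spiral_exponent_def Re_exp r_def)
  have "\<bar>Im (Ln s) / 2\<bar> \<le> 1" using i r by linarith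
  then have "(Im (Ln s) / 2)^2 \<le> (1/10)^2" using i r by (intro abs_le_square_iff[THEN iffD1]) auto
  moreover have "(sin (Im (Ln s) / 4))\<^sup>2 \<le> (Im (Ln s) / 4)\<^sup>2"
    by (intro abs_le_square_iff[THEN iffD1] abs_sin_x_le_abs_x)
  ultimately have "9/10 \<le> cos (Im (Ln s) / 2)"
    using cos_double_sin[of "Im (Ln s) / 4"] by (simp add: power2_eq_square)
  then have "9/10 * r \<le> r * cos (Im (Ln s) / 2)" "r * cos (Im (Ln s) / 2) \<le> r"
    using r by (auto simp: field_simps)
  then show "4/5 * (1 / sqrt (norm s)) \<le> Im (spiral_exponent s)"
    "Im (spiral_exponent s) \<le> 11/10 * (1 / sqrt (norm s))"
    using i r unfolding e r_def[symmetric] by linarith+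
qed

lemma norm_spiral: "norm (spiral s) = exp (- Im (spiral_exponent s))"
  by (simp add: spiral_def)

lemma spiral_in_disc:
  assumes "s \<in> spiral_dom"
  shows "norm (spiral s) < 1"
proof -
  have "0 < 1 / sqrt (norm s)" using spiral_dom_nonzero[OF assms] by simp
  then have "0 < Im (spiral_exponent s)" using Im_spiral_exponent_bounds(1)[OF assms] by linarith
  then show ?thesis by (simp add: norm_spiral)
qed

text \<open>Equal values mean exponents differing by \<open>2 * k * pi\<close>. Their imaginary
  parts then agree, so the moduli of the parameters differ by a factor of at most \<open>4\<close>
  and the real parts of the logarithms by at most \<open>2\<close>. This is too little for a full
  turn, so \<open>k = 0\<close> and the lower Lipschitz bound finishes.\<close>

lemma spiral_inj: "inj_on spiral spiral_dom"
proof -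
  have *: "s = s'" if s: "s \<in> spiral_dom" "s' \<in> spiral_dom" and eq: "spiral s = spiral s'"
    and le: "norm s' \<le> norm s" for s s'
  proof -
    define r where "r = 1 / sqrt (norm s)"
    define r' where "r' = 1 / sqrt (norm s')"
    have n: "norm s > 0" "s \<noteq> 0" "norm s' > 0" "s' \<noteq> 0" using norm_ge_spiral_dom[OF s(1)] norm_ge_spiral_dom[OF s(2)] by auto
    have r: "0 < r" "r \<le> 1/100" "0 < r'" "r' \<le> 1/100"
      using n inverse_sqrt_norm_le[OF s(1)] inverse_sqrt_norm_le[OF s(2)] unfolding r_def r'_def by simp_all
    obtain k :: int where k: "\<i> * spiral_exponent s = \<i> * spiral_exponent s' + (of_int (2 * k) * pi) * \<i>"
      using eq unfolding spiral_def exp_eq by auto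
    then have k2: "spiral_exponent s = spiral_exponent s' + of_int (2 * k) * pi"
    proof -
      have "\<i> * spiral_exponent s = \<i> * (spiral_exponent s' + of_int (2 * k) * pi)"
        unfolding k by (simp add: algebra_simps)
      then show ?thesis by (simp only: mult_cancel_left) simp
    qed
    have Ln_le: "Re (Ln s) - Re (Ln s') \<le> 2"
    proof -
      have "Im (spiral_exponent s) = Im (spiral_exponent s')"
        using k2 by simp
      then have "r' \<le> 2 * r"
        using Im_spiral_exponent_bounds[OF s(1)] Im_spiral_exponent_bounds[OF s(2)] r
        unfolding r_def[symmetric] r'_def[symmetric] by linarith
      then have "sqrt (norm s) \<le> sqrt (4 * norm s')"
        using n by (simp add: r_def r'_def field_simps real_sqrt_mult)
      then have "norm s / norm s' \<le> 4"
        using n by (simp add: field_simps)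
      also have "4 \<le> exp (2::real)"
      proof -
        have "2 \<le> exp (1::real)" using exp_ge_add_one_self[of 1] by simp
        from mult_mono[OF this this] show ?thesis by (simp flip: exp_add)
      qed
      finally have "ln (norm s / norm s') \<le> 2"
        using n by (metis divide_pos_pos exp_gt_zero ln_exp ln_le_cancel_iff)
      then show ?thesis using n by (simp add: ln_div)
    qed
    have Ln_ge: "0 \<le> Re (Ln s) - Re (Ln s')"
      using n le by simp
    have "Re (spiral_exponent s) - Re (spiral_exponent s') = 2 * of_int k * pi"
      using k2 by simp
    moreover have "\<bar>Im (exp (- Ln s / 2))\<bar> \<le> 1/100" "\<bar>Im (exp (- Ln s' / 2))\<bar> \<le> 1/100"
      using abs_Im_le_cmod[of "exp (- Ln s / 2)"] abs_Im_le_cmod[of "exp (- Ln s' / 2)"] r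
      unfolding norm_exp_half_Ln[OF n(2)] norm_exp_half_Ln[OF n(4)] r_def r'_def by linarith+
    ultimately have "\<bar>2 * of_int k * pi\<bar> < 2 * pi"
      using Ln_le Ln_ge pi_gt3 by (simp add: spiral_exponent_def del: Re_Ln)
    then have "k = 0" by (simp add: abs_mult)
    then have "spiral_exponent s = spiral_exponent s'" using k2 by simp
    then have "Ln s = Ln s'"
      using spiral_exponent_bilipschitz(1)[of s s'] norm_ge_spiral_dom[OF s(1)] norm_ge_spiral_dom[OF s(2)]
      by simp
    then show "s = s'" using n by (metis exp_Ln)
  qed
  show ?thesis
  proof (rule inj_onI)
    fix s s' assume "s \<in> spiral_dom" "s' \<in> spiral_dom" "spiral s = spiral s'"
    then show "s = s'"
      using *[of s s'] *[of s' s] by (cases "norm s' \<le> norm s") auto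
  qed
qed

section \<open>Quantitative separation in the image of the strip\<close>

lemma norm_exp_minus_one_ge:
  fixes q :: complex
  assumes "norm q \<le> 1/4"
  shows "norm q / 2 \<le> norm (exp q - 1)"
proof -
  have a: "norm (exp x - 1) \<le> 1 / 2" if "norm x \<le> 1/4" for x :: complex
  proof -
    have "norm (exp x - exp 0) \<le> 2 * norm (x - 0)"
    proof (rule field_differentiable_bound[where S = "cball 0 (1/4)"])
      fix y :: complex assume "y \<in> cball 0 (1/4)"
      then show "norm (exp y) \<le> 2" using exp_bound_lemma[of y] by simp
    qed (use that in \<open>auto intro!: derivative_eq_intros\<close>)
    then show ?thesis using that by simp
  qed
  \<comment> \<open>Again a perturbation of the identity: \<open>exp q - q\<close> has derivative
    \<open>exp q - 1\<close>, of modulus at most \<open>1/2\<close> on this disc.\<close>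
  have "norm ((exp q - q) - (exp 0 - 0)) \<le> 1/2 * norm (q - 0)"
  proof (rule field_differentiable_bound[where S = "cball 0 (1/4)" and f = "\<lambda>q. exp q - q" and f' = "\<lambda>q. exp q - 1"])
    fix y :: complex assume "y \<in> cball 0 (1/4)"
    then show "norm (exp y - 1) \<le> 1/2" using a by simp
  qed (use assms in \<open>auto intro!: derivative_eq_intros\<close>)
  moreover have "norm q \<le> norm ((exp q - 1)) + norm ((exp q - q) - (exp 0 - 0))"
    using norm_triangle_ineq4[of "exp q - 1" "exp q - q - 1"] by simp
  ultimately show ?thesis by simp
qed

lemma Ln_diff_bounds:
  assumes "s \<in> spiral_dom" "s' \<in> spiral_dom"
  shows "norm (Ln s' - Ln s) \<le> norm (s' - s) / 10000"
    and "norm (s' - s) \<le> max (norm s) (norm s') * norm (Ln s' - Ln s)"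
proof -
  have "norm (Ln s' - Ln s) \<le> 1 / 10000 * norm (s' - s)"
  proof (rule field_differentiable_bound[where S = "spiral_dom"])
    fix x :: complex assume x: "x \<in> spiral_dom"
    show "(Ln has_field_derivative inverse x) (at x within spiral_dom)"
      using spiral_dom_notin_nonpos[OF x]
      by (rule has_field_derivative_at_within[OF has_field_derivative_Ln])
    show "norm (inverse x) \<le> 1 / 10000"
      using norm_ge_spiral_dom[OF x] le_imp_inverse_le[of 10000 "norm x"] by (simp add: norm_inverse)
  qed (use assms convex_half_strip in auto)
  then show "norm (Ln s' - Ln s) \<le> norm (s' - s) / 10000" by simp
  define m where "m = max (norm s) (norm s')"
  have n: "s \<noteq> 0" "s' \<noteq> 0" using spiral_dom_nonzero assms by auto
  have "norm (exp (Ln s') - exp (Ln s)) \<le> m * norm (Ln s' - Ln s)"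
  proof (rule field_differentiable_bound[where S = "{w. Re w \<le> ln m}"])
    show "convex {w. Re w \<le> ln m}"
      using convex_halfspace_Re_le by simp
    have "0 < m" using n by (simp add: m_def less_max_iff_disj)
    fix x :: complex assume x: "x \<in> {w. Re w \<le> ln m}"
    then have "exp (Re x) \<le> exp (ln m)" by simp
    then show "norm (exp x) \<le> m" using \<open>0 < m\<close> by simp
  qed (use n in \<open>auto intro!: derivative_eq_intros simp: m_def less_max_iff_disj ln_le_cancel_iff\<close>)
  then show "norm (s' - s) \<le> max (norm s) (norm s') * norm (Ln s' - Ln s)"
    using n by (simp add: m_def)
qed

text \<open>The separation \<open>1/2\<close> becomes at least \<open>1 / (4 * norm s)\<close> under
  \<open>Ln\<close>, \<open>1 / (8 * norm s)\<close> for the exponents and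
  \<open>1 / (16 * norm s)\<close> after exponentiating; the last factor is
  \<open>1/2 \<le> norm (spiral s)\<close>.\<close>

lemma spiral_diff_ge:
  assumes "s \<in> spiral_dom" "s' \<in> spiral_dom" "norm (s' - s) = 1/2"
  shows "1 / (32 * norm s) \<le> norm (spiral s' - spiral s)"
proof -
  define q where "q = \<i> * (spiral_exponent s' - spiral_exponent s)"
  have n: "10000 < norm s" "10000 < norm s'" using norm_ge_spiral_dom assms by auto
  have "norm q \<le> 2 * norm (Ln s' - Ln s)" "norm (Ln s' - Ln s) / 2 \<le> norm q"
    using spiral_exponent_bilipschitz[of s' s] n by (auto simp: q_def norm_mult)
  moreover have "norm (Ln s' - Ln s) \<le> 1/2 / 10000"
    using Ln_diff_bounds(1)[OF assms(1,2)] assms(3) by simp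
  moreover have "max (norm s) (norm s') \<le> 2 * norm s"
    using norm_triangle_ineq2[of s' s] assms(3) n by auto
  then have "1/2 \<le> 2 * norm s * norm (Ln s' - Ln s)"
    using Ln_diff_bounds(2)[OF assms(1,2)] assms(3)
    by (smt (verit) mult_right_mono norm_ge_zero)
  then have "1 / (4 * norm s) \<le> norm (Ln s' - Ln s)"
    using n by (subst pos_divide_le_eq) (auto simp: mult_ac)
  ultimately have q: "norm q \<le> 1/4" "1 / (4 * norm s) \<le> 2 * norm q" by linarith+
  have "spiral s' - spiral s = spiral s * (exp q - 1)"
    by (simp add: q_def spiral_def algebra_simps flip: exp_add)
  then have e: "norm (spiral s' - spiral s) = norm (spiral s) * norm (exp q - 1)"
    by (simp add: norm_mult)
  have "1/2 \<le> norm (spiral s)"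
    using Im_spiral_exponent_bounds(2)[OF assms(1)] inverse_sqrt_norm_le[OF assms(1)]
      exp_ge_add_one_self[of "- Im (spiral_exponent s)"] unfolding norm_spiral by linarith
  moreover have "1 / (16 * norm s) \<le> norm (exp q - 1)"
    using norm_exp_minus_one_ge[OF q(1)] q(2) n by (simp add: field_simps)
  ultimately have "1/2 * (1 / (16 * norm s)) \<le> norm (spiral s) * norm (exp q - 1)"
    using n by (intro mult_mono) auto
  then show ?thesis unfolding e by simp
qed

text \<open>Control on the boundary circle suffices: an open map that keeps the circle at distance
  \<open>r\<close> from the image of the centre covers the ball of radius \<open>r\<close> about
  that image, so an uncovered point lies outside it.\<close>

lemma spiral_dist_ge:
  assumes s: "cball s (1/2) \<subseteq> spiral_dom" and z: "z \<notin> spiral ` cball s (1/2)"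
  shows "1 / (32 * norm s) \<le> norm (spiral s - z)"
proof -
  have n: "s \<in> spiral_dom" using s by auto
  have "ball (spiral s) (1 / (32 * norm s)) \<subseteq> spiral ` cball s (1/2)"
  proof (rule ball_subset_open_map_image)
    show "continuous_on (closure (cball s (1/2))) spiral"
      using holomorphic_on_imp_continuous_on[OF spiral_holomorphic] s
      by (auto intro: continuous_on_subset)
    have "ball s (1/2) \<subseteq> spiral_dom" using s by force
    then show "open (spiral ` interior (cball s (1/2)))"
      using open_mapping_thm3[of spiral "ball s (1/2)"] spiral_inj spiral_holomorphic
      by (auto intro: inj_on_subset holomorphic_on_subset)
    fix w assume "w \<in> frontier (cball s (1/2))"
    then have "norm (w - s) = 1/2" "w \<in> cball s (1/2)" by (auto simp: dist_norm norm_minus_commute)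
    then show "1 / (32 * norm s) \<le> norm (spiral w - spiral s)"
      using spiral_diff_ge[OF n, of w] s by auto
  qed (use norm_ge_spiral_dom[OF n] in auto)
  then have "z \<notin> ball (spiral s) (1 / (32 * norm s))" using z by blast
  then show ?thesis by (simp add: dist_norm)
qed

lemma norm_deriv_spiral_le:
  assumes "s \<in> spiral_dom"
  shows "norm (deriv spiral s) \<le> 1"
proof -
  have n: "10000 < norm s" using norm_ge_spiral_dom assms by auto
  define e where "e = 1 - \<i> / 2 * exp (- Ln s / 2)"
  have "norm e \<le> norm (1::complex) + norm (\<i> / 2 * exp (- Ln s / 2))"
    unfolding e_def by (rule norm_triangle_ineq4)
  also have "norm (\<i> / 2 * exp (- Ln s / 2)) = 1/2 * (1 / sqrt (norm s))"
    unfolding norm_mult norm_exp_half_Ln[OF spiral_dom_nonzero[OF assms]] by (simp add: norm_divide)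
  finally have "norm e \<le> 2" using inverse_sqrt_norm_le[OF assms] by simp
  then have e: "norm e / norm s \<le> 1" using n by (subst pos_divide_le_eq) auto
  have "norm (deriv spiral s) = norm (spiral s) * (norm e / norm s)"
    by (simp add: DERIV_imp_deriv[OF spiral_has_deriv[OF assms]] e_def norm_mult norm_divide)
  also have "\<dots> \<le> 1 * 1"
    using spiral_in_disc[OF assms] e by (intro mult_mono) auto
  finally show ?thesis by simp
qed

lemma norm_spiral_gt_eventually:
  assumes "\<rho> < 1"
  obtains N where "N \<ge> 10000" "\<And>s. s \<in> spiral_dom \<Longrightarrow> N \<le> Re s \<Longrightarrow> \<rho> < norm (spiral s)"
proof
  define e where "e = (1 - \<rho>)"
  have e: "e > 0" using assms by (simp add: e_def)
  fix s assume s: "s \<in> spiral_dom" "max 10000 ((2 / e)\<^sup>2) \<le> Re s"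
  have "(2 / e)\<^sup>2 \<le> norm s" using s complex_Re_le_cmod[of s] by simp
  then have "2 / e \<le> sqrt (norm s)" by (rule real_le_rsqrt)
  then have "1 / sqrt (norm s) \<le> e / 2" using e spiral_dom_nonzero[OF s(1)] by (simp add: field_simps)
  then show "\<rho> < norm (spiral s)"
    using Im_spiral_exponent_bounds(2)[OF s(1)] e
      exp_ge_add_one_self[of "- Im (spiral_exponent s)"] unfolding norm_spiral e_def by argo
qed simp

subsection \<open>Cauchy integrals over the band\<close>

text \<open>The Cauchy kernel at \<open>z\<close> for the function that equals
  \<open>exp (exp s)\<close> at \<open>spiral s\<close>, pulled back to the parameter plane so that
  all contours consist of straight segments.\<close>

definition spiral_kernel :: "complex \<Rightarrow> complex \<Rightarrow> complex" where
  "spiral_kernel z s = exp (exp s) * deriv spiral s / (spiral s - z)"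

text \<open>Over a closed rectangle the integral of the kernel is \<open>2 * pi * \<i> * exp (exp s0)\<close> if \<open>z = spiral s0\<close>
  with \<open>s0\<close> inside, and \<open>0\<close> if \<open>z\<close> is not in the image.  Since the horizontal sides contribute little,
  the integral over the vertical side at abscissa \<open>N\<close> converges as \<open>N\<close> grows.\<close>

definition cross_integral :: "real \<Rightarrow> real \<Rightarrow> complex \<Rightarrow> complex" where
  "cross_integral a N z =
     contour_integral (linepath (Complex N (- a)) (Complex N a)) (spiral_kernel z) / (2 * pi * \<i>)"

lemma deriv_spiral_holomorphic: "deriv spiral holomorphic_on spiral_dom"
  by (intro holomorphic_deriv spiral_holomorphic open_half_strip)

lemma spiral_kernel_holomorphic:
  assumes "S \<subseteq> spiral_dom" "z \<notin> spiral ` S"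
  shows "spiral_kernel z holomorphic_on S"
  unfolding spiral_kernel_def
  by (intro holomorphic_intros holomorphic_on_subset[OF deriv_spiral_holomorphic assms(1)]
      holomorphic_on_subset[OF spiral_holomorphic assms(1)]) (use assms(2) in auto)

section \<open>Residue, decay, and integrals over rectangles\<close>

lemma spiral_kernel_has_contour_integral_inside:
  assumes "s0 \<in> spiral_dom" "valid_path \<gamma>" "path_image \<gamma> \<subseteq> spiral_dom - {s0}"
    "pathfinish \<gamma> = pathstart \<gamma>"
  shows "(spiral_kernel (spiral s0) has_contour_integral 2 * pi * \<i> * winding_number \<gamma> s0 * exp (exp s0)) \<gamma>"
proof -
  \<comment> \<open>The difference quotient of \<open>spiral\<close>, completed at
    \<open>s0\<close>. Injectivity keeps it nonzero, so the kernel has only a simple pole at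
    \<open>s0\<close>, with residue \<open>exp (exp s0)\<close>.\<close>
  define q where "q s = (if s = s0 then deriv spiral s0 else (spiral s - spiral s0) / (s - s0))" for s
  have q0: "q s \<noteq> 0" if "s \<in> spiral_dom" for s
    using holomorphic_injective_imp_regular[OF spiral_holomorphic open_half_strip spiral_inj assms(1)]
      inj_onD[OF spiral_inj _ that assms(1)] by (auto simp: q_def)
  have "q holomorphic_on spiral_dom"
    unfolding q_def by (intro pole_lemma_open spiral_holomorphic open_half_strip)
  then have "(\<lambda>s. exp (exp s) * deriv spiral s / q s) holomorphic_on spiral_dom"
    by (intro holomorphic_intros deriv_spiral_holomorphic q0) auto
  from Cauchy_integral_formula_convex_simple[OF convex_half_strip this _ assms(2,3,4)]
  have "((\<lambda>w. exp (exp w) * deriv spiral w / q w / (w - s0)) has_contour_integral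
      2 * pi * \<i> * winding_number \<gamma> s0 * (exp (exp s0) * deriv spiral s0 / q s0)) \<gamma>"
    using assms(1) by (simp add: interior_open open_half_strip)
  moreover have "exp (exp s0) * deriv spiral s0 / q s0 = exp (exp s0)"
    using q0[OF assms(1)] by (simp add: q_def)
  ultimately have "((\<lambda>w. exp (exp w) * deriv spiral w / q w / (w - s0)) has_contour_integral
      2 * pi * \<i> * winding_number \<gamma> s0 * exp (exp s0)) \<gamma>" by simp
  then show ?thesis
  proof (rule has_contour_integral_eq)
    fix w assume "w \<in> path_image \<gamma>"
    then have "w \<noteq> s0" using assms(3) by auto
    then show "exp (exp w) * deriv spiral w / q w / (w - s0) = spiral_kernel (spiral s0) w"
      by (simp add: q_def spiral_kernel_def)
  qed
qed

lemma spiral_kernel_bound: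
  assumes s: "cball s (1/2) \<subseteq> spiral_dom" and z: "z \<notin> spiral ` cball s (1/2)"
  shows "norm (spiral_kernel z s) \<le> norm (exp (exp s)) * (32 * norm s)"
proof -
  have sd: "s \<in> spiral_dom" using s by auto
  have n: "0 < norm s" using spiral_dom_nonzero[OF sd] by simp
  have d: "1 / (32 * norm s) \<le> norm (spiral s - z)" using spiral_dist_ge[OF s z] .
  have "norm (deriv spiral s) / norm (spiral s - z) \<le> 1 / (1 / (32 * norm s))"
    using n d norm_deriv_spiral_le[OF sd] by (intro frac_le) auto
  then have "norm (exp (exp s)) * (norm (deriv spiral s) / norm (spiral s - z))
      \<le> norm (exp (exp s)) * (32 * norm s)"
    by (intro mult_left_mono) auto
  then show ?thesis by (simp add: spiral_kernel_def norm_mult norm_divide)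
qed

lemma cball_half_strip:
  assumes "M + 1/2 < Re s" "\<bar>Im s\<bar> + 1/2 < A"
  shows "cball s (1/2) \<subseteq> half_strip M A"
proof
  fix w assume "w \<in> cball s (1/2)"
  then have "norm (s - w) \<le> 1/2" by (simp add: dist_norm)
  then show "w \<in> half_strip M A"
    using assms abs_Re_le_cmod[of "s - w"] abs_Im_le_cmod[of "s - w"]
    by (auto simp: half_strip_def abs_le_iff)
qed

lemma cos_le_minus_half:
  assumes "2 * pi / 3 \<le> \<bar>x\<bar>" "\<bar>x\<bar> \<le> pi"
  shows "cos x \<le> - 1/2"
proof -
  have "cos \<bar>x\<bar> \<le> cos (2 * pi / 3)"
    using assms by (intro cos_monotone_0_pi_le) auto
  then show ?thesis by (simp add: cos_120)
qed

lemma norm_exp_exp: "norm (exp (exp s)) = exp (exp (Re s) * cos (Im s))"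
  by (simp add: Re_exp)

text \<open>A cosine of at most \<open>-1/2\<close> gives the factor
  \<open>exp (- exp u / 2)\<close>, which swallows the loss \<open>32 * norm s\<close>. Only
  \<open>exp (- Re s)\<close> is kept, because its integral from \<open>n\<close> onwards is
  \<open>exp (- n)\<close>, whatever the right end of the edge.\<close>

lemma spiral_kernel_decay:
  assumes s: "10001 \<le> Re s" "2 * pi / 3 \<le> \<bar>Im s\<bar>" "\<bar>Im s\<bar> \<le> pi"
    and z: "z \<notin> spiral ` cball s (1/2)"
  shows "norm (spiral_kernel z s) \<le> exp (- Re s)"
proof -
  define u where "u = Re s"
  have u: "10001 \<le> u" using s by (simp add: u_def)
  have "norm (spiral_kernel z s) \<le> norm (exp (exp s)) * (32 * norm s)"
    using s z pi_approx by (intro spiral_kernel_bound cball_half_strip) auto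
  moreover have "norm (exp (exp s)) \<le> exp (- exp u / 2)"
    using mult_left_mono[OF cos_le_minus_half[OF s(2,3)], of "exp u"]
    unfolding norm_exp_exp u_def[symmetric] by simp
  moreover have "norm s \<le> 2 * u"
    using cmod_le[of s] s pi_less_4 u by (simp add: u_def)
  moreover have "exp (- exp u / 2) * (32 * (2 * u)) \<le> exp (- u)"
  proof -
    have "64 * u \<le> u * u" using u by (intro mult_right_mono) auto
    also have "\<dots> \<le> exp u * exp u"
      using u exp_ge_add_one_self[of u] by (intro mult_mono order.trans[OF _ exp_ge_add_one_self]) auto
    finally have a: "64 * u \<le> exp (2 * u)" by (simp flip: exp_add)
    have "u\<^sup>2 / 2 \<le> exp u"
      using exp_lower_Taylor_quadratic[of u] u by simp
    moreover have "12 * u \<le> u\<^sup>2" using u unfolding power2_eq_square by (intro mult_right_mono) auto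
    ultimately have b: "3 * u \<le> exp u / 2" by simp
    have "exp (- exp u / 2) * (64 * u) \<le> exp (- (3 * u)) * exp (2 * u)"
      using a b u by (intro mult_mono) auto
    then show ?thesis by (simp flip: exp_add)
  qed
  moreover have "norm (exp (exp s)) * (32 * norm s) \<le> exp (- exp u / 2) * (32 * (2 * u))"
    using calculation(2,3) by (intro mult_mono) auto
  ultimately show ?thesis unfolding u_def by linarith
qed

lemma linepath_horizontal: "linepath (Complex n b) (Complex N b) x = Complex (n + x * (N - n)) b"
  by (simp add: linepath_def complex_eq_iff algebra_simps)

lemma contour_integral_horizontal_bound:
  assumes "n \<le> N" and cont: "continuous_on (closed_segment (Complex n b) (Complex N b)) h"
    and bound: "\<And>u. n \<le> u \<Longrightarrow> norm (h (Complex u b)) \<le> exp (- u)"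
  shows "norm (contour_integral (linepath (Complex n b) (Complex N b)) h) \<le> exp (- n)"
proof -
  define F where "F x = h (linepath (Complex n b) (Complex N b) x) * (Complex N b - Complex n b)" for x
  define G where "G x = exp (- (n + x * (N - n))) * (N - n)" for x
  have "(F has_integral contour_integral (linepath (Complex n b) (Complex N b)) h) {0..1}"
    unfolding F_def has_contour_integral_linepath[symmetric]
    by (intro has_contour_integral_integral contour_integrable_continuous_linepath cont)
  moreover have G: "(G has_integral (- exp (- (n + 1 * (N - n))) - - exp (- (n + 0 * (N - n))))) {0..1}"
  proof (rule fundamental_theorem_of_calculus)
    fix x :: real
    show "((\<lambda>x. - exp (- (n + x * (N - n)))) has_vector_derivative G x) (at x within {0..1})"
      unfolding G_def has_real_derivative_iff_has_vector_derivative[symmetric]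
      by (auto intro!: derivative_eq_intros simp: algebra_simps)
  qed (use assms(1) in simp)
  moreover have "norm (F x) \<le> G x" if "x \<in> {0..1}" for x
  proof -
    have "n \<le> n + x * (N - n)" using that assms(1) by simp
    moreover have "norm (Complex N b - Complex n b) = N - n"
      using assms(1) by (simp add: cmod_def)
    ultimately show ?thesis
      using bound[of "n + x * (N - n)"] assms(1)
      unfolding F_def G_def norm_mult linepath_horizontal by (intro mult_mono) auto
  qed
  ultimately have "norm (contour_integral (linepath (Complex n b) (Complex N b)) h)
      \<le> - exp (- (n + 1 * (N - n))) - - exp (- (n + 0 * (N - n)))"
    using integral_norm_bound_integral[of F "{0..1}" G]
    by (metis has_integral_integrable integral_unique)
  also have "\<dots> \<le> exp (- n)" by simp
  finally show ?thesis .
qed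

text \<open>Not only the two horizontal edges but their \<open>1/2\<close>-neighbourhoods in the
  parameter plane are excluded, as the kernel estimate demands. Full half-lines are used so that a
  single assumption serves all right ends \<open>N\<close>.\<close>

definition avoids_edges :: "real \<Rightarrow> real \<Rightarrow> complex \<Rightarrow> bool" where
  "avoids_edges a n z \<longleftrightarrow> (\<forall>s. n \<le> Re s \<and> \<bar>Im s\<bar> = a \<longrightarrow> z \<notin> spiral ` cball s (1/2))"

lemma closed_segment_horizontal:
  assumes "n \<le> N" "s \<in> closed_segment (Complex n b) (Complex N b)"
  shows "n \<le> Re s" "Re s \<le> N" "Im s = b"
  using assms closed_segment_same_Im[of "Complex n b" "Complex N b"]
  by (auto simp: closed_segment_eq_real_ivl)

lemma closed_segment_vertical:
  assumes "c \<le> d" "s \<in> closed_segment (Complex n c) (Complex n d)"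
  shows "Re s = n" "c \<le> Im s" "Im s \<le> d"
  using assms closed_segment_same_Re[of "Complex n c" "Complex n d"]
  by (auto simp: closed_segment_eq_real_ivl)

text \<open>The four sides of the rectangle sum to \<open>2 * pi * \<i> * I\<close>, and the
  horizontal ones contribute at most \<open>exp (- n)\<close> each. Leaving \<open>I\<close> open
  lets the cases without a pole and with one share the argument.\<close>

lemma cross_integral_diff:
  assumes n: "10001 \<le> n" "n \<le> N" and a: "2 * pi / 3 \<le> a" "a \<le> pi"
    and edges: "avoids_edges a n z"
    and sides: "\<And>s. Re s \<in> {n, N} \<Longrightarrow> \<bar>Im s\<bar> \<le> a \<Longrightarrow> spiral s \<noteq> z"
    and I: "(spiral_kernel z has_contour_integral 2 * pi * \<i> * I)
      (rectpath (Complex n (- a)) (Complex N a))"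
  shows "norm (cross_integral a N z - cross_integral a n z - I) \<le> exp (- n)"
proof -
  have a4: "0 < a" "a < 4" using a pi_gt_zero pi_less_4 by linarith+
  have edge: "norm (contour_integral (linepath (Complex n b) (Complex N b)) (spiral_kernel z)) \<le> exp (- n)"
      "spiral_kernel z contour_integrable_on (linepath (Complex n b) (Complex N b))"
    if b: "\<bar>b\<bar> = a" for b
  proof -
    have "z \<notin> spiral ` closed_segment (Complex n b) (Complex N b)"
      using edges closed_segment_horizontal[OF n(2), of _ b] b
      unfolding avoids_edges_def by (fastforce simp: image_iff)
    moreover have "closed_segment (Complex n b) (Complex N b) \<subseteq> spiral_dom"
      using closed_segment_horizontal[OF n(2), of _ b] b a4 n by (force simp: half_strip_def)
    ultimately have c: "continuous_on (closed_segment (Complex n b) (Complex N b)) (spiral_kernel z)"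
      by (intro holomorphic_on_imp_continuous_on spiral_kernel_holomorphic)
    show "spiral_kernel z contour_integrable_on (linepath (Complex n b) (Complex N b))"
      by (intro contour_integrable_continuous_linepath c)
    show "norm (contour_integral (linepath (Complex n b) (Complex N b)) (spiral_kernel z)) \<le> exp (- n)"
    proof (rule contour_integral_horizontal_bound[OF n(2) c])
      fix u assume "n \<le> u"
      then show "norm (spiral_kernel z (Complex u b)) \<le> exp (- u)"
        using spiral_kernel_decay[of "Complex u b" z] n a b edges by (auto simp: avoids_edges_def)
    qed
  qed
  have side: "spiral_kernel z contour_integrable_on (linepath (Complex m (- a)) (Complex m a))"
    if m: "m \<in> {n, N}" for m
  proof -
    have "spiral s \<noteq> z" if "s \<in> closed_segment (Complex m (- a)) (Complex m a)" for s
      using sides[of s] closed_segment_vertical[OF _ that] m a4 by auto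
    then have "z \<notin> spiral ` closed_segment (Complex m (- a)) (Complex m a)" by auto
    moreover have "closed_segment (Complex m (- a)) (Complex m a) \<subseteq> spiral_dom"
    proof
      fix s assume "s \<in> closed_segment (Complex m (- a)) (Complex m a)"
      then have "Re s = m" "- a \<le> Im s" "Im s \<le> a"
        using closed_segment_vertical[of "- a" a s m] a4 by auto
      then show "s \<in> spiral_dom" using m n a4 by (auto simp: half_strip_def)
    qed
    ultimately show ?thesis
      by (intro contour_integrable_continuous_linepath holomorphic_on_imp_continuous_on spiral_kernel_holomorphic)
  qed
  define B where "B = contour_integral (linepath (Complex n (- a)) (Complex N (- a))) (spiral_kernel z)"
  define T where "T = contour_integral (linepath (Complex n a) (Complex N a)) (spiral_kernel z)"
  have bottom: "(spiral_kernel z has_contour_integral B) (linepath (Complex n (- a)) (Complex N (- a)))"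
    unfolding B_def using a4 by (intro has_contour_integral_integral edge(2)) auto
  have "(spiral_kernel z has_contour_integral T) (linepath (Complex n a) (Complex N a))"
    unfolding T_def using a4 by (intro has_contour_integral_integral edge(2)) auto
  note top = has_contour_integral_reverse_linepath[OF this]
  have vert: "(spiral_kernel z has_contour_integral 2 * pi * \<i> * cross_integral a m z)
      (linepath (Complex m (- a)) (Complex m a))" if "m \<in> {n, N}" for m
    using has_contour_integral_integral[OF side[OF that]] by (simp add: cross_integral_def)
  have right: "(spiral_kernel z has_contour_integral 2 * pi * \<i> * cross_integral a N z)
      (linepath (Complex N (- a)) (Complex N a))" by (intro vert) simp
  have left: "(spiral_kernel z has_contour_integral - (2 * pi * \<i> * cross_integral a n z))
      (linepath (Complex n a) (Complex n (- a)))"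
    by (intro has_contour_integral_reverse_linepath vert) simp
  have "(spiral_kernel z has_contour_integral (B + (2 * pi * \<i> * cross_integral a N z +
      (- T + - (2 * pi * \<i> * cross_integral a n z))))) (rectpath (Complex n (- a)) (Complex N a))"
    unfolding rectpath_def Let_def complex.sel
    by (intro has_contour_integral_join bottom right top left valid_path_join valid_path_linepath) simp_all
  from has_contour_integral_unique[OF I this]
  have "2 * pi * \<i> * I = B + (2 * pi * \<i> * cross_integral a N z +
      (- T + - (2 * pi * \<i> * cross_integral a n z)))" .
  then have "2 * pi * \<i> * (cross_integral a N z - cross_integral a n z - I) = T - B"
    by (simp add: algebra_simps)
  then have "norm (2 * pi * \<i> * (cross_integral a N z - cross_integral a n z - I)) = norm (T - B)"
    by simp
  then have "2 * pi * norm (cross_integral a N z - cross_integral a n z - I) = norm (T - B)"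
    by (simp add: norm_mult)
  also have "\<dots> \<le> 2 * exp (- n)"
    using edge(1)[of a] edge(1)[of "- a"] a4 norm_triangle_ineq4[of T B]
    unfolding T_def B_def by simp
  finally have "pi * norm (cross_integral a N z - cross_integral a n z - I) \<le> exp (- n)" by simp
  moreover have "1 * norm (cross_integral a N z - cross_integral a n z - I)
      \<le> pi * norm (cross_integral a N z - cross_integral a n z - I)"
    using pi_ge_two by (intro mult_right_mono) auto
  ultimately show ?thesis by simp
qed

lemma rectpath_in_spiral_dom:
  assumes "10001 \<le> n" "n \<le> N" "0 < a" "a < 4"
  shows "cbox (Complex n (- a)) (Complex N a) \<subseteq> spiral_dom"
    and "path_image (rectpath (Complex n (- a)) (Complex N a)) \<subseteq> cbox (Complex n (- a)) (Complex N a)"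
proof -
  show "cbox (Complex n (- a)) (Complex N a) \<subseteq> spiral_dom"
    using assms by (auto simp: half_strip_def in_cbox_complex_iff)
  show "path_image (rectpath (Complex n (- a)) (Complex N a)) \<subseteq> cbox (Complex n (- a)) (Complex N a)"
    using assms by (intro path_image_rectpath_subset_cbox) auto
qed

lemma cross_integral_diff_outside:
  assumes n: "10001 \<le> n" "n \<le> N" and a: "2 * pi / 3 \<le> a" "a \<le> pi"
    and edges: "avoids_edges a n z"
    and out: "\<And>s. n \<le> Re s \<Longrightarrow> \<bar>Im s\<bar> \<le> a \<Longrightarrow> spiral s \<noteq> z"
  shows "norm (cross_integral a N z - cross_integral a n z) \<le> exp (- n)"
proof -
  have a4: "0 < a" "a < 4" using a pi_gt_zero pi_less_4 by linarith+
  have "z \<notin> spiral ` cbox (Complex n (- a)) (Complex N a)"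
    using out by (force simp: in_cbox_complex_iff)
  then have "spiral_kernel z holomorphic_on cbox (Complex n (- a)) (Complex N a)"
    using rectpath_in_spiral_dom[OF n a4] by (intro spiral_kernel_holomorphic)
  then have "(spiral_kernel z has_contour_integral 0) (rectpath (Complex n (- a)) (Complex N a))"
    using rectpath_in_spiral_dom(2)[OF n a4]
    by (intro Cauchy_theorem_convex_simple[where S = "cbox (Complex n (- a)) (Complex N a)"])
       (auto intro: convex_box)
  then have "norm (cross_integral a N z - cross_integral a n z - 0) \<le> exp (- n)"
    by (intro cross_integral_diff n a edges) (use out n in auto)
  then show ?thesis by simp
qed

lemma cross_integral_diff_inside:
  assumes n: "10001 \<le> n" "n < Re s0" "Re s0 < N" and a: "2 * pi / 3 \<le> a" "a \<le> pi" "\<bar>Im s0\<bar> < a"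
    and edges: "avoids_edges a n (spiral s0)"
  shows "norm (cross_integral a N (spiral s0) - cross_integral a n (spiral s0) - exp (exp s0)) \<le> exp (- n)"
proof -
  have a4: "0 < a" "a < 4" using a pi_gt_zero pi_less_4 by linarith+
  have n': "n \<le> N" using n by simp
  have box: "s0 \<in> box (Complex n (- a)) (Complex N a)"
    using n a by (auto simp: in_box_complex_iff)
  have s0: "s0 \<in> spiral_dom"
    using rectpath_in_spiral_dom[OF n(1) n' a4] box box_subset_cbox by blast
  have "s0 \<notin> path_image (rectpath (Complex n (- a)) (Complex N a))"
    using box n' a4 by (auto simp: path_image_rectpath_cbox_minus_box)
  then have "(spiral_kernel (spiral s0) has_contour_integral 2 * pi * \<i> *
      winding_number (rectpath (Complex n (- a)) (Complex N a)) s0 * exp (exp s0))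
      (rectpath (Complex n (- a)) (Complex N a))"
    using rectpath_in_spiral_dom[OF n(1) n' a4]
    by (intro spiral_kernel_has_contour_integral_inside s0) auto
  then have I: "(spiral_kernel (spiral s0) has_contour_integral 2 * pi * \<i> * exp (exp s0))
      (rectpath (Complex n (- a)) (Complex N a))"
    using winding_number_rectpath[OF box] by simp
  show ?thesis
  proof (rule cross_integral_diff[OF n(1) n' a(1,2) edges _ I])
    fix s assume s: "Re s \<in> {n, N}" "\<bar>Im s\<bar> \<le> a"
    then have "s \<in> spiral_dom" using n a4 by (auto simp: half_strip_def)
    then show "spiral s \<noteq> spiral s0"
      using inj_onD[OF spiral_inj _ _ s0, of s] s n by auto
  qed
qed

text \<open>A crude bound suffices: it is applied at fixed abscissae, where it supplies the additive
  constant of the comparison with \<open>exp (exp s)\<close>. The length \<open>2 * a\<close> of the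
  segment is absorbed by the normalising factor \<open>2 * pi\<close>.\<close>

lemma cross_integral_bound:
  assumes n: "10001 \<le> n" and a: "0 < a" "a \<le> pi"
    and out: "\<And>s. Re s = n \<Longrightarrow> \<bar>Im s\<bar> \<le> a \<Longrightarrow> z \<notin> spiral ` cball s (1/2)"
  shows "norm (cross_integral a n z) \<le> exp (exp n) * (32 * (n + 4))"
proof -
  define K where "K = exp (exp n) * (32 * (n + 4))"
  have K: "0 \<le> K" using n by (simp add: K_def)
  have seg: "Re s = n" "\<bar>Im s\<bar> \<le> a" if "s \<in> closed_segment (Complex n (- a)) (Complex n a)" for s
    using closed_segment_vertical[OF _ that] a by auto
  have "z \<notin> spiral ` closed_segment (Complex n (- a)) (Complex n a)"
    using seg out by fastforce
  moreover have "closed_segment (Complex n (- a)) (Complex n a) \<subseteq> spiral_dom"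
    using seg n a pi_less_4 by (force simp: half_strip_def)
  ultimately have "spiral_kernel z contour_integrable_on (linepath (Complex n (- a)) (Complex n a))"
    by (intro contour_integrable_continuous_linepath holomorphic_on_imp_continuous_on spiral_kernel_holomorphic)
  then have "norm (contour_integral (linepath (Complex n (- a)) (Complex n a)) (spiral_kernel z))
      \<le> K * norm (Complex n a - Complex n (- a))"
  proof (rule has_contour_integral_bound_linepath[OF has_contour_integral_integral K])
    fix s assume "s \<in> closed_segment (Complex n (- a)) (Complex n a)"
    note s = seg[OF this]
    have "\<bar>Im s\<bar> + 1/2 < 4" using s a pi_approx by simp
    then have "norm (spiral_kernel z s) \<le> norm (exp (exp s)) * (32 * norm s)"
      using s n out by (intro spiral_kernel_bound cball_half_strip) auto
    also have "\<dots> \<le> exp (exp n) * (32 * (n + 4))"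
    proof (intro mult_mono)
      show "norm (exp (exp s)) \<le> exp (exp n)"
        using mult_left_mono[OF cos_le_one[of "Im s"], of "exp n"] unfolding norm_exp_exp s(1) by simp
      show "norm s \<le> n + 4" using cmod_le[of s] s n a pi_less_4 by simp
    qed auto
    finally show "norm (spiral_kernel z s) \<le> K" by (simp add: K_def)
  qed
  also have "norm (Complex n a - Complex n (- a)) = 2 * a"
    using a by (simp add: cmod_def real_sqrt_mult)
  finally have "norm (contour_integral (linepath (Complex n (- a)) (Complex n a)) (spiral_kernel z)) \<le> K * (2 * pi)"
    using K a by (smt (verit) mult_left_mono)
  then show ?thesis
    by (simp add: cross_integral_def norm_divide norm_mult K_def pos_divide_le_eq)
qed

section \<open>The limit function and its bounds\<close>

text \<open>Pulling the vertical side back to a fixed abscissa shows, for \<open>z\<close> off the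
  contour, the Cauchy integral over the U-shaped boundary of the band, plus the residue
  \<open>exp (exp s)\<close> when \<open>z = spiral s\<close> lies inside. Over a straight half
  strip the same integrand gives the classical entire function that is bounded outside it. As the
  segments leave every compact part of the disc, no gluing across a contour is required.\<close>

definition tract_function :: "complex \<Rightarrow> complex" where
  "tract_function z = lim (\<lambda>N. cross_integral (2 * pi / 3) (real N) z)"

text \<open>The image of the whole segment lies outside the disc of radius \<open>\<rho>\<close>, so
  the denominator has no zero there and differentiation under the integral sign applies.\<close>

lemma cross_integral_holomorphic:
  assumes N: "10001 \<le> N" and a: "0 < a" "a < 4"
    and gt: "\<And>s. Re s = N \<Longrightarrow> \<bar>Im s\<bar> \<le> a \<Longrightarrow> \<rho> < norm (spiral s)"
  shows "cross_integral a N holomorphic_on ball 0 \<rho>"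
proof -
  define p where "p x = linepath (Complex N (- a)) (Complex N a) x" for x
  define c where "c = Complex N a - Complex N (- a)"
  have p: "p x \<in> spiral_dom" "\<rho> < norm (spiral (p x))" if "x \<in> {0..1}" for x
  proof -
    have "p x \<in> closed_segment (Complex N (- a)) (Complex N a)"
      using that linepath_in_path by (simp add: p_def)
    from closed_segment_vertical[OF _ this] have "Re (p x) = N" "\<bar>Im (p x)\<bar> \<le> a"
      using a by auto
    then show "p x \<in> spiral_dom" "\<rho> < norm (spiral (p x))"
      using N a gt by (auto simp: half_strip_def)
  qed
  have pc: "continuous_on S p" for S unfolding p_def by (intro continuous_intros)
  define q where "q x = exp (exp (p x)) * deriv spiral (p x) * c" for x
  have qc: "continuous_on {0..1} q" unfolding q_def
    by (intro continuous_intros pc continuous_on_compose2[OF holomorphic_on_imp_continuous_on[OF deriv_spiral_holomorphic]])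
       (use p in auto)
  have sc: "continuous_on {0..1} (\<lambda>x. spiral (p x))"
    by (intro continuous_on_compose2[OF holomorphic_on_imp_continuous_on[OF spiral_holomorphic]] pc) (use p in auto)
  have nz: "spiral (p x) - z \<noteq> 0" if "z \<in> ball 0 \<rho>" "x \<in> {0..1}" for x and z :: complex
    using p(2)[OF that(2)] that(1) by auto
  have "(\<lambda>z. integral (cbox 0 1) (\<lambda>x. q x / (spiral (p x) - z))) holomorphic_on ball 0 \<rho>"
  proof (rule leibniz_rule_holomorphic)
    fix z :: complex and x :: real assume zx: "z \<in> ball 0 \<rho>" "x \<in> cbox 0 1"
    then show "((\<lambda>z. q x / (spiral (p x) - z)) has_field_derivative q x / (spiral (p x) - z)\<^sup>2) (at z within ball 0 \<rho>)"
      using nz[of z x] by (auto intro!: derivative_eq_intros simp: power2_eq_square field_simps)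
  next
    fix z :: complex assume z: "z \<in> ball 0 \<rho>"
    show "(\<lambda>x. q x / (spiral (p x) - z)) integrable_on cbox 0 1"
      by (intro integrable_continuous) (use nz z in \<open>auto intro!: continuous_intros qc sc\<close>)
  next
    have "continuous_on (ball 0 \<rho> \<times> cbox 0 1) (\<lambda>y. q (snd y) / (spiral (p (snd y)) - fst y)\<^sup>2)"
      by (intro continuous_intros continuous_on_compose2[OF qc] continuous_on_compose2[OF sc])
         (use nz in auto)
    then show "continuous_on (ball 0 \<rho> \<times> cbox 0 1) (\<lambda>(z, x). q x / (spiral (p x) - z)\<^sup>2)"
      by (simp add: case_prod_unfold)
  qed auto
  moreover have "integral (cbox 0 1) (\<lambda>x. q x / (spiral (p x) - z)) =
      contour_integral (linepath (Complex N (- a)) (Complex N a)) (spiral_kernel z)" for z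
    unfolding contour_integral_integral vector_derivative_linepath_at
    by (simp add: spiral_kernel_def q_def p_def c_def mult_ac)
  ultimately show ?thesis
    unfolding cross_integral_def by (auto intro!: holomorphic_intros)
qed

text \<open>The far part of the strip is mapped off any given smaller disc, so estimates there are
  uniform in \<open>z\<close>. The unit margin to the left of \<open>M\<close> leaves room for the
  discs of radius \<open>1/2\<close> in \<open>avoids_edges\<close>.\<close>

lemma far_spiral:
  assumes "\<rho> < 1"
  obtains M where "10002 \<le> M" "\<And>s. M - 1 \<le> Re s \<Longrightarrow> \<bar>Im s\<bar> < 4 \<Longrightarrow> \<rho> < norm (spiral s)"
    and "\<And>n a z. M \<le> n \<Longrightarrow> a \<le> pi \<Longrightarrow> norm z \<le> \<rho> \<Longrightarrow> avoids_edges a n z"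
proof -
  obtain M where M: "M \<ge> 10000" "\<And>s. s \<in> spiral_dom \<Longrightarrow> M \<le> Re s \<Longrightarrow> \<rho> < norm (spiral s)"
    using norm_spiral_gt_eventually[OF assms] by blast
  have far: "\<rho> < norm (spiral s)" if "M + 2 - 1 \<le> Re s" "\<bar>Im s\<bar> < 4" for s
    using that M by (auto simp: half_strip_def)
  have "avoids_edges a n z" if n: "M + 2 \<le> n" "a \<le> pi" "norm z \<le> \<rho>" for a n z
    unfolding avoids_edges_def
  proof (intro allI impI)
    fix s assume s: "n \<le> Re s \<and> \<bar>Im s\<bar> = a"
    have "cball s (1/2) \<subseteq> half_strip (M + 1) 4"
      using s n pi_approx by (intro cball_half_strip) auto
    then have "spiral w \<noteq> z" if "w \<in> cball s (1/2)" for w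
      using far[of w] n that by (auto simp: half_strip_def)
    then show "z \<notin> spiral ` cball s (1/2)" by blast
  qed
  with M(1) far show ?thesis by (intro that[of "M + 2"]) auto
qed

text \<open>Rectangles beyond \<open>M\<close> carry no pole for any \<open>z\<close> in the disc,
  so by Cauchy's theorem two cross integrals differ only by the small edge terms. This is a Cauchy
  criterion uniform in \<open>z\<close>.\<close>

lemma cross_integral_converges:
  assumes "\<rho> < 1"
  shows "uniform_limit (cball 0 \<rho>) (\<lambda>N. cross_integral (2 * pi / 3) (real N)) tract_function sequentially"
proof -
  obtain M where M: "10002 \<le> M" "\<And>s. M - 1 \<le> Re s \<Longrightarrow> \<bar>Im s\<bar> < 4 \<Longrightarrow> \<rho> < norm (spiral s)"
    "\<And>n a z. M \<le> n \<Longrightarrow> a \<le> pi \<Longrightarrow> norm z \<le> \<rho> \<Longrightarrow> avoids_edges a n z"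
    using far_spiral[OF assms] by metis
  have diff: "norm (cross_integral (2 * pi / 3) N z - cross_integral (2 * pi / 3) n z) \<le> exp (- n)"
    if "M \<le> n" "n \<le> N" "norm z \<le> \<rho>" for n N z
  proof (rule cross_integral_diff_outside)
    fix s assume "n \<le> Re s" "\<bar>Im s\<bar> \<le> 2 * pi / 3"
    then show "spiral s \<noteq> z" using M(2)[of s] that pi_less_4 by auto
  qed (use M that in auto)
  have "uniformly_Cauchy_on (cball 0 \<rho>) (\<lambda>N. cross_integral (2 * pi / 3) (real N))"
  proof (rule uniformly_Cauchy_onI')
    fix e :: real assume "0 < e"
    \<comment> \<open>The summand \<open>1\<close> makes \<open>exp (- k)\<close> strictly smaller
      than \<open>e\<close>.\<close>
    obtain k where k: "max M (1 - ln e) \<le> real k"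
      using real_arch_simple by blast
    show "\<exists>K. \<forall>z\<in>cball 0 \<rho>. \<forall>m\<ge>K. \<forall>n>m. dist (cross_integral (2 * pi / 3) (real m) z) (cross_integral (2 * pi / 3) (real n) z) < e"
    proof (intro exI[of _ k] ballI allI impI)
      fix z :: complex and m n assume z: "z \<in> cball 0 \<rho>" "k \<le> m" "m < n"
      have "dist (cross_integral (2 * pi / 3) (real m) z) (cross_integral (2 * pi / 3) (real n) z) \<le> exp (- real m)"
        using diff[of "real m" "real n" z] z k by (simp add: dist_norm norm_minus_commute)
      also have "\<dots> < exp (ln e)" using z k by (subst exp_less_cancel_iff) linarith
      finally show "dist (cross_integral (2 * pi / 3) (real m) z) (cross_integral (2 * pi / 3) (real n) z) < e"
        using \<open>0 < e\<close> by simp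
    qed
  qed
  then have "uniformly_convergent_on (cball 0 \<rho>) (\<lambda>N. cross_integral (2 * pi / 3) (real N))"
    by (rule Cauchy_uniformly_convergent)
  then show ?thesis
    unfolding tract_function_def by (simp add: uniformly_convergent_uniform_limit_iff)
qed

lemma cross_integral_tendsto:
  assumes "norm z < 1"
  shows "(\<lambda>N. cross_integral (2 * pi / 3) (real N) z) \<longlonglongrightarrow> tract_function z"
  using cross_integral_converges[OF assms] by (rule tendsto_uniform_limitI) simp

lemma tract_function_holomorphic: "tract_function holomorphic_on ball 0 1"
proof -
  have "tract_function holomorphic_on ball 0 \<rho>" if "\<rho> < 1" for \<rho>
  proof -
    obtain M where M: "10002 \<le> M" "\<And>s. M - 1 \<le> Re s \<Longrightarrow> \<bar>Im s\<bar> < 4 \<Longrightarrow> \<rho> < norm (spiral s)"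
      using far_spiral[OF \<open>\<rho> < 1\<close>] by metis
    obtain k where k: "M \<le> real k" using real_arch_simple by blast
    show ?thesis
    proof (rule holomorphic_uniform_sequence)
      \<comment> \<open>The shift by \<open>k\<close> discards the early segments, whose images may
        still meet the disc of radius \<open>\<rho>\<close>.\<close>
      show "cross_integral (2 * pi / 3) (real (n + k)) holomorphic_on ball 0 \<rho>" for n
        using M k pi_less_4 by (intro cross_integral_holomorphic M(2)) auto
      fix x :: complex assume "x \<in> ball 0 \<rho>"
      then obtain d where d: "0 < d" "cball x d \<subseteq> ball 0 \<rho>"
        using open_contains_cball open_ball by blast
      have "uniform_limit (cball x d) (\<lambda>N. cross_integral (2 * pi / 3) (real N)) tract_function sequentially"
        using cross_integral_converges[OF \<open>\<rho> < 1\<close>] by (rule uniform_limit_on_subset) (use d(2) ball_subset_cball in blast)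
      then have "uniform_limit (cball x d) (\<lambda>n. cross_integral (2 * pi / 3) (real (n + k))) tract_function sequentially"
        by (rule filterlim_compose) (rule filterlim_add_const_nat_at_top)
      then show "\<exists>d>0. cball x d \<subseteq> ball 0 \<rho> \<and>
          uniform_limit (cball x d) (\<lambda>n. cross_integral (2 * pi / 3) (real (n + k))) tract_function sequentially"
        using d by blast
    qed simp
  qed
  then have "tract_function field_differentiable at z" if "z \<in> ball 0 1" for z
  proof -
    obtain \<rho> where "norm z < \<rho>" "\<rho> < 1" using dense[of "norm z" 1] \<open>z \<in> ball 0 1\<close> by auto
    then show ?thesis
      using \<open>\<And>\<rho>. \<rho> < 1 \<Longrightarrow> tract_function holomorphic_on ball 0 \<rho>\<close>[of \<rho>]
      by (auto simp: holomorphic_on_open field_differentiable_def)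
  qed
  then show ?thesis by (auto simp: holomorphic_on_def field_differentiable_at_within)
qed

text \<open>At the same abscissa the two segments differ by two pieces with heights between
  \<open>2 * pi / 3\<close> and \<open>pi\<close>, where the kernel decays. Hence both contours
  define the same function.\<close>

lemma cross_integral_tendsto_wide:
  assumes z: "norm z < 1"
  shows "(\<lambda>N. cross_integral pi (real N) z) \<longlonglongrightarrow> tract_function z"
proof -
  obtain M where M: "10002 \<le> M" "\<And>s. M - 1 \<le> Re s \<Longrightarrow> \<bar>Im s\<bar> < 4 \<Longrightarrow> norm z < norm (spiral s)"
    using far_spiral[OF z] by metis
  have pi4: "pi + 1/2 < 4" "2 * pi / 3 \<le> pi" using pi_approx by auto
  have "norm (cross_integral pi (real N) z - cross_integral (2 * pi / 3) (real N) z) \<le> exp (- real N)"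
    if N: "M \<le> real N" for N
  proof -
    define J where "J c d = contour_integral (linepath (Complex N c) (Complex N d)) (spiral_kernel z)" for c d
    have cont: "continuous_on (closed_segment (Complex N c) (Complex N d)) (spiral_kernel z)"
      if "- pi \<le> c" "c \<le> d" "d \<le> pi" for c d
    proof (intro holomorphic_on_imp_continuous_on spiral_kernel_holomorphic)
      have s: "Re s = N" "\<bar>Im s\<bar> < 4" if "s \<in> closed_segment (Complex N c) (Complex N d)" for s
        using closed_segment_vertical[OF \<open>c \<le> d\<close> that] \<open>- pi \<le> c\<close> \<open>d \<le> pi\<close> pi4 by auto
      then show "closed_segment (Complex N c) (Complex N d) \<subseteq> spiral_dom"
        using N M(1) by (auto simp: half_strip_def)
      have "spiral s \<noteq> z" if "s \<in> closed_segment (Complex N c) (Complex N d)" for s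
        using M(2)[of s] s[OF that] N by auto
      then show "z \<notin> spiral ` closed_segment (Complex N c) (Complex N d)" by auto
    qed
    have split: "J c e = J c d + J d e" if "- pi \<le> c" "c \<le> d" "d \<le> e" "e \<le> pi" for c d e
      unfolding J_def
    proof (rule contour_integral_split_linepath)
      show "Complex N d \<in> closed_segment (Complex N c) (Complex N e)"
        using that closed_segment_same_Re[of "Complex N c" "Complex N e"] by (simp add: closed_segment_eq_real_ivl)
      show "continuous_on (closed_segment (Complex N c) (Complex N e)) (spiral_kernel z)"
        by (rule cont) (use that in auto)
    qed
    have short: "norm (J c d) \<le> exp (- real N) * (pi / 3)"
      if cd: "- pi \<le> c" "c \<le> d" "d \<le> pi" "d - c = pi / 3"
        and ge: "\<And>y. c \<le> y \<Longrightarrow> y \<le> d \<Longrightarrow> 2 * pi / 3 \<le> \<bar>y\<bar>" for c d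
    proof -
      have "norm (J c d) \<le> exp (- real N) * norm (Complex N d - Complex N c)"
        unfolding J_def
      proof (rule has_contour_integral_bound_linepath)
        show "(spiral_kernel z has_contour_integral
            contour_integral (linepath (Complex N c) (Complex N d)) (spiral_kernel z)) (linepath (Complex N c) (Complex N d))"
          by (intro has_contour_integral_integral contour_integrable_continuous_linepath cont cd)
        fix s assume "s \<in> closed_segment (Complex N c) (Complex N d)"
        from closed_segment_vertical[OF cd(2) this] have s: "Re s = N" "c \<le> Im s" "Im s \<le> d" by auto
        have "cball s (1/2) \<subseteq> half_strip (M - 1) 4"
          using s cd N pi4 by (intro cball_half_strip) auto
        then have "spiral w \<noteq> z" if "w \<in> cball s (1/2)" for w
          using M(2)[of w] that by (auto simp: half_strip_def)
        then have "z \<notin> spiral ` cball s (1/2)" by blast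
        then have "norm (spiral_kernel z s) \<le> exp (- Re s)"
          using s cd ge N M(1) by (intro spiral_kernel_decay) auto
        then show "norm (spiral_kernel z s) \<le> exp (- real N)" using s by simp
      qed simp
      also have "norm (Complex N d - Complex N c) = pi / 3"
        using cd by (simp add: cmod_def)
      finally show ?thesis .
    qed
    have "J (- pi) pi = J (- pi) (- (2 * pi / 3)) + J (- (2 * pi / 3)) (2 * pi / 3) + J (2 * pi / 3) pi"
      using split[of "- pi" "- (2 * pi / 3)" pi] split[of "- (2 * pi / 3)" "2 * pi / 3" pi] pi_gt_zero by simp
    then have "cross_integral pi (real N) z - cross_integral (2 * pi / 3) (real N) z
        = (J (- pi) (- (2 * pi / 3)) + J (2 * pi / 3) pi) / (2 * pi * \<i>)"
      by (simp add: cross_integral_def J_def diff_divide_distrib[symmetric])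
    then have "norm (cross_integral pi (real N) z - cross_integral (2 * pi / 3) (real N) z)
        = norm (J (- pi) (- (2 * pi / 3)) + J (2 * pi / 3) pi) / (2 * pi)"
      by (simp add: norm_divide norm_mult)
    also have "\<dots> \<le> (2 * (exp (- real N) * (pi / 3))) / (2 * pi)"
      using short[of "- pi" "- (2 * pi / 3)"] short[of "2 * pi / 3" pi] pi_gt_zero
      by (intro divide_right_mono norm_triangle_le) auto
    also have "\<dots> \<le> exp (- real N)" by (simp add: field_simps)
    finally show ?thesis .
  qed
  moreover have "\<forall>\<^sub>F N in sequentially. M \<le> real N"
    by real_asymp
  ultimately have "\<forall>\<^sub>F N in sequentially.
      norm (cross_integral pi (real N) z - cross_integral (2 * pi / 3) (real N) z) \<le> exp (- real N)"
    by (rule eventually_mono[rotated])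
  moreover have "(\<lambda>N. exp (- real N)) \<longlonglongrightarrow> 0"
    by real_asymp
  ultimately have "(\<lambda>N. cross_integral pi (real N) z - cross_integral (2 * pi / 3) (real N) z) \<longlonglongrightarrow> 0"
    by (rule Lim_null_comparison)
  from tendsto_add[OF this cross_integral_tendsto[OF z]] show ?thesis by simp
qed

lemma spiral_dom_separated:
  assumes "s0 \<in> spiral_dom" "cball s (1/2) \<subseteq> spiral_dom" "s0 \<notin> cball s (1/2)"
  shows "spiral s0 \<notin> spiral ` cball s (1/2)"
proof
  assume "spiral s0 \<in> spiral ` cball s (1/2)"
  then obtain w where w: "w \<in> cball s (1/2)" "spiral w = spiral s0" by auto
  then have "w = s0" using inj_onD[OF spiral_inj] assms by blast
  then show False using w assms by simp
qed

text \<open>Each point keeps distance \<open>1/2\<close> (in the half strip) from one of the two contours: inside the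
  band the wide one of height \<open>pi\<close> is used, elsewhere the one of height \<open>2 * pi / 3\<close>.\<close>

lemma tract_function_bounds:
  obtains B where
    "\<And>s. s \<in> half_strip 20000 (5 * pi / 6) \<Longrightarrow> norm (tract_function (spiral s) - exp (exp s)) \<le> B"
    "\<And>z. norm z < 1 \<Longrightarrow> z \<notin> spiral ` half_strip 20000 (5 * pi / 6) \<Longrightarrow> norm (tract_function z) \<le> B"
proof -
  define C where "C n = exp (exp n) * (32 * (n + 4))" for n :: real
  \<comment> \<open>The wide contour starts at \<open>19999\<close> and the narrow one at
    \<open>20001\<close>, one unit on either side of the end of the strip and so farther than
    \<open>1/2\<close> from it. The summand \<open>1\<close> covers the edges.\<close>
  define B where "B = max (C 20001) (C 19999) + 1"
  have pis: "pi + 1/2 < 4" "3 < pi" using pi_approx by auto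
  have "norm (tract_function (spiral s0) - exp (exp s0)) \<le> B"
    if s0: "s0 \<in> half_strip 20000 (5 * pi / 6)" for s0
  proof -
    have s0': "s0 \<in> spiral_dom" "20000 < Re s0" "\<bar>Im s0\<bar> < 5 * pi / 6"
      using s0 pis by (auto simp: half_strip_def)
    have avoid: "spiral s0 \<notin> spiral ` cball s (1/2)"
      if s: "19999 \<le> Re s" "\<bar>Im s\<bar> \<le> pi" "\<bar>Im s\<bar> = pi \<or> Re s = 19999" for s
    proof (rule spiral_dom_separated[OF s0'(1)])
      show "cball s (1/2) \<subseteq> spiral_dom" using s pis by (intro cball_half_strip) auto
      \<comment> \<open>Either the heights differ by more than \<open>pi / 6\<close> or the
        abscissae by more than \<open>1\<close>.\<close>
      have "1/2 < norm (s - s0)"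
        using s s0' pis abs_Re_le_cmod[of "s - s0"] abs_Im_le_cmod[of "s - s0"] by (auto simp: abs_if split: if_splits)
      then show "s0 \<notin> cball s (1/2)" by (simp add: dist_norm)
    qed
    have edges: "avoids_edges pi 19999 (spiral s0)"
      unfolding avoids_edges_def using avoid by auto
    have "(\<lambda>N. cross_integral pi (real N) (spiral s0) - cross_integral pi 19999 (spiral s0) - exp (exp s0))
        \<longlonglongrightarrow> tract_function (spiral s0) - cross_integral pi 19999 (spiral s0) - exp (exp s0)"
      by (intro tendsto_intros cross_integral_tendsto_wide spiral_in_disc s0')
    moreover have "\<forall>\<^sub>F N in sequentially. Re s0 < real N"
      by real_asymp
    then have "\<forall>\<^sub>F N in sequentially.
        norm (cross_integral pi (real N) (spiral s0) - cross_integral pi 19999 (spiral s0) - exp (exp s0)) \<le> 1"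
    proof eventually_elim
      case (elim N)
      then have "norm (cross_integral pi (real N) (spiral s0) - cross_integral pi 19999 (spiral s0) - exp (exp s0)) \<le> exp (- 19999)"
        using s0' pis by (intro cross_integral_diff_inside edges) auto
      also have "\<dots> \<le> 1" by simp
      finally show ?case .
    qed
    ultimately have "norm (tract_function (spiral s0) - cross_integral pi 19999 (spiral s0) - exp (exp s0)) \<le> 1"
      by (intro Lim_norm_ubound[OF sequentially_bot])
    moreover have "norm (cross_integral pi 19999 (spiral s0)) \<le> C 19999"
      unfolding C_def using avoid pis by (intro cross_integral_bound) auto
    ultimately show ?thesis
      using norm_triangle_ineq[of "tract_function (spiral s0) - cross_integral pi 19999 (spiral s0) - exp (exp s0)"
          "cross_integral pi 19999 (spiral s0)"]
      by (simp add: B_def)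
  qed
  moreover have "norm (tract_function z) \<le> B"
    if z: "norm z < 1" "z \<notin> spiral ` half_strip 20000 (5 * pi / 6)" for z
  proof -
    define a where "a = 2 * pi / 3"
    have a: "0 < a" "a \<le> pi" "2 * pi / 3 \<le> a" "a + 1/2 < 5 * pi / 6" using pis by (auto simp: a_def)
    have avoid: "z \<notin> spiral ` cball s (1/2)" if "20001 \<le> Re s" "\<bar>Im s\<bar> \<le> a" for s
    proof -
      have "cball s (1/2) \<subseteq> half_strip 20000 (5 * pi / 6)"
        using that a by (intro cball_half_strip) auto
      then show ?thesis using z by blast
    qed
    have edges: "avoids_edges a 20001 z"
      unfolding avoids_edges_def using avoid by auto
    have "(\<lambda>N. cross_integral a (real N) z - cross_integral a 20001 z) \<longlonglongrightarrow> tract_function z - cross_integral a 20001 z"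
      unfolding a_def by (intro tendsto_intros cross_integral_tendsto z)
    moreover have "\<forall>\<^sub>F N in sequentially. 20001 \<le> real N"
      by real_asymp
    then have "\<forall>\<^sub>F N in sequentially. norm (cross_integral a (real N) z - cross_integral a 20001 z) \<le> 1"
    proof eventually_elim
      case (elim N)
      have "norm (cross_integral a (real N) z - cross_integral a 20001 z) \<le> exp (- 20001)"
        using elim a avoid by (intro cross_integral_diff_outside edges) (force+)
      also have "\<dots> \<le> 1" by simp
      finally show ?case .
    qed
    ultimately have "norm (tract_function z - cross_integral a 20001 z) \<le> 1"
      by (intro Lim_norm_ubound[OF sequentially_bot])
    moreover have "norm (cross_integral a 20001 z) \<le> C 20001"
      unfolding C_def using avoid a by (intro cross_integral_bound) auto
    ultimately show ?thesis
      using norm_triangle_ineq[of "tract_function z - cross_integral a 20001 z" "cross_integral a 20001 z"]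
      by (simp add: B_def)
  qed
  ultimately show ?thesis by (rule that)
qed

subsection \<open>Boundary behaviour\<close>

lemma half_strip_mono: "M' \<le> M \<Longrightarrow> A \<le> A' \<Longrightarrow> half_strip M A \<subseteq> half_strip M' A'"
  by (auto simp: half_strip_def)

lemma eventually_at_left_1_obtain:
  assumes "eventually P (at_left (1::real))"
  obtains t0 where "0 \<le> t0" "t0 < 1" "\<And>t. t0 < t \<Longrightarrow> t < 1 \<Longrightarrow> P t"
proof -
  obtain b where "b < 1" "\<And>t. b < t \<Longrightarrow> t < 1 \<Longrightarrow> P t"
    using assms unfolding eventually_at_left_field by blast
  then show ?thesis by (intro that[of "max 0 b"]) auto
qed

lemma boundary_path_norm_less: "boundary_path \<Gamma> \<Longrightarrow> 0 \<le> t \<Longrightarrow> t < 1 \<Longrightarrow> norm (\<Gamma> t) < 1"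
  by (auto simp: boundary_path_def image_subset_iff)

text \<open>The part of the closure outside a ball about \<open>\<zeta>\<close> is a compact subset
  of the open disc, hence bounded in modulus by some \<open>c < 1\<close>; the path eventually has
  modulus above \<open>c\<close>.\<close>

lemma boundary_path_converges:
  assumes "boundary_path \<Gamma>" "path_end \<Gamma> = {\<zeta>}"
  shows "norm \<zeta> = 1" "(\<Gamma> \<longlongrightarrow> \<zeta>) (at_left 1)"
proof -
  show "norm \<zeta> = 1" using assms(2) by (auto simp: path_end_def)
  show "(\<Gamma> \<longlongrightarrow> \<zeta>) (at_left 1)"
  proof (rule tendstoI)
    fix e :: real assume e: "0 < e"
    define K where "K = closure (\<Gamma> ` {0..<1}) - ball \<zeta> e"
    have sub: "closure (\<Gamma> ` {0..<1}) \<subseteq> cball 0 1"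
      using boundary_path_norm_less[OF assms(1)] by (intro closure_minimal) (auto simp: less_imp_le)
    then have "bounded (closure (\<Gamma> ` {0..<1}))"
      using bounded_subset bounded_cball by blast
    then have comp: "compact K"
      unfolding K_def by (intro compact_diff) (auto simp: compact_eq_bounded_closed)
    have "norm z < 1" if "z \<in> K" for z
    proof -
      have "z \<notin> path_end \<Gamma>" using that assms(2) e by (auto simp: K_def)
      then have "norm z \<noteq> 1" using that by (auto simp: path_end_def K_def)
      then show ?thesis using sub that by (force simp: K_def)
    qed
    then obtain c where c: "c < 1" "\<And>z. z \<in> K \<Longrightarrow> norm z \<le> c"
    proof (cases "K = {}")
      case False
      then obtain z where "z \<in> K" "\<forall>w\<in>K. norm w \<le> norm z"
        using continuous_attains_sup[OF comp, of norm] continuous_on_norm_id by blast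
      with that[of "norm z"] \<open>\<And>z. z \<in> K \<Longrightarrow> norm z < 1\<close> show ?thesis by blast
    qed (use that[of 0] in auto)
    have "\<forall>\<^sub>F t in at_left 1. c < norm (\<Gamma> t)"
      using assms(1) c(1) unfolding boundary_path_def by (auto dest: order_tendstoD)
    moreover have "\<forall>\<^sub>F t in at_left 1. t \<in> {0<..<1::real}"
      by (rule eventually_at_left_real) simp
    ultimately show "\<forall>\<^sub>F t in at_left 1. dist (\<Gamma> t) \<zeta> < e"
    proof eventually_elim
      case (elim t)
      then have "\<Gamma> t \<in> closure (\<Gamma> ` {0..<1})" by (intro closure_subset[THEN subsetD] imageI) auto
      moreover have "\<Gamma> t \<notin> K" using c(2)[of "\<Gamma> t"] elim by auto
      ultimately show ?case by (auto simp: K_def dist_commute)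
    qed
  qed
qed

lemma spiral_of_real:
  assumes "0 < u"
  shows "spiral (of_real u) = exp (\<i> * ln u - 1 / sqrt u)"
proof -
  have "exp (- (of_real (ln u) / 2)) = complex_of_real (exp (- (ln u / 2)))"
    by (simp add: exp_of_real[symmetric])
  also have "exp (- (ln u / 2)) = 1 / sqrt u"
    using assms by (simp add: exp_minus ln_sqrt[symmetric] field_simps)
  finally show ?thesis
    using assms by (simp add: spiral_def spiral_exponent_def Ln_of_real algebra_simps)
qed

text \<open>An intermediate value argument in logarithmic coordinates. Near \<open>\<zeta>\<close>
  the path is \<open>exp (\<i> * X - Y)\<close> with \<open>X\<close> bounded and \<open>Y\<close>
  tending to \<open>0\<close>, and a turn of the spiral is the graph of
  \<open>exp (- (X + 2 * pi * k) / 2)\<close>. The path starts above this graph and ends below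
  it.\<close>

lemma path_crosses_spiral:
  assumes \<Gamma>: "boundary_path \<Gamma>" and \<zeta>: "norm \<zeta> = 1" "(\<Gamma> \<longlongrightarrow> \<zeta>) (at_left 1)"
    and t1: "0 \<le> t1" "t1 < 1"
  obtains t u where "t1 < t" "t < 1" "U < u" "0 < u" "\<Gamma> t = spiral (of_real u)"
proof -
  have "\<forall>\<^sub>F t in at_left 1. dist (\<Gamma> t) \<zeta> < 1/2"
    using \<zeta>(2) by (rule tendstoD) simp
  from eventually_at_left_1_obtain[OF this] obtain t0 where t0: "0 \<le> t0" "t0 < 1"
    "\<And>t. t0 < t \<Longrightarrow> t < 1 \<Longrightarrow> dist (\<Gamma> t) \<zeta> < 1/2" by blast
  obtain t2 where t2: "max t0 t1 < t2" "t2 < 1" using dense[of "max t0 t1" 1] t0 t1 by auto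
  define w where "w t = Ln (\<Gamma> t / \<zeta>)" for t
  define \<alpha> where "\<alpha> = Arg \<zeta>"
  have "\<zeta> \<noteq> 0" using \<zeta>(1) by auto
  then have \<zeta>eq: "\<zeta> = exp (\<i> * \<alpha>)" using Arg_eq[of \<zeta>] \<zeta>(1) unfolding \<alpha>_def by simp
  have near: "dist 1 (\<Gamma> t / \<zeta>) < 1/2" if "t2 \<le> t" "t < 1" for t
  proof -
    have "1 - \<Gamma> t / \<zeta> = (\<zeta> - \<Gamma> t) / \<zeta>" using \<open>\<zeta> \<noteq> 0\<close> by (simp add: field_simps)
    then have "dist 1 (\<Gamma> t / \<zeta>) = dist (\<Gamma> t) \<zeta>"
      using \<zeta> by (simp add: dist_norm norm_divide norm_minus_commute)
    then show ?thesis using t0(3)[of t] that t2 by simp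
  qed
  have Repos: "0 < Re (\<Gamma> t / \<zeta>)" if "t2 \<le> t" "t < 1" for t
    using near[OF that] abs_Re_le_cmod[of "1 - \<Gamma> t / \<zeta>"] unfolding dist_norm by simp
  then have slit: "\<Gamma> t / \<zeta> \<notin> \<real>\<^sub>\<le>\<^sub>0" "\<Gamma> t / \<zeta> \<noteq> 0" if "t2 \<le> t" "t < 1" for t
    using Repos[OF that] complex_nonpos_Reals_iff[of "\<Gamma> t / \<zeta>"] by fastforce+
  define Y where "Y t = - Re (w t)" for t
  define X where "X t = Im (w t) + \<alpha>" for t
  have \<Gamma>c: "continuous_on {0..<1} \<Gamma>" using \<Gamma> by (simp add: boundary_path_def)
  have wc: "continuous_on {t2..<1} w"
    unfolding w_def
    by (intro continuous_intros continuous_on_subset[OF \<Gamma>c]) (use slit t0 t2 \<open>\<zeta> \<noteq> 0\<close> in auto)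
  have \<Gamma>eq: "\<Gamma> t = exp (\<i> * X t - Y t)" if "t2 \<le> t" "t < 1" for t
  proof -
    have "\<i> * X t - Y t = \<i> * \<alpha> + w t"
      by (simp add: X_def Y_def complex_eq_iff)
    then have "exp (\<i> * X t - Y t) = \<zeta> * exp (w t)" by (simp add: \<zeta>eq exp_add)
    also have "\<dots> = \<Gamma> t" using slit[OF that] \<zeta> by (simp add: w_def)
    finally show ?thesis by simp
  qed
  have Yeq: "norm (\<Gamma> t) = exp (- Y t)" if "t2 \<le> t" "t < 1" for t
    by (simp add: \<Gamma>eq[OF that])
  have Ypos: "0 < Y t2"
    using Yeq[of t2] boundary_path_norm_less[OF \<Gamma>, of t2] t0 t2 by simp
  have Xb: "\<bar>X t\<bar> \<le> 2 * pi" if "t2 \<le> t" "t < 1" for t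
    using slit(2)[OF that] mpi_less_Im_Ln[of "\<Gamma> t / \<zeta>"] Im_Ln_le_pi[of "\<Gamma> t / \<zeta>"] mpi_less_Arg[of \<zeta>] Arg_le_pi[of \<zeta>]
    unfolding X_def \<alpha>_def w_def by (simp add: abs_if)
  \<comment> \<open>The first entry puts the turn below the path at \<open>t2\<close>, the second
    makes the crossing parameter exceed \<open>U\<close>, and \<open>2 * pi\<close> absorbs
    \<open>X\<close>.\<close>
  obtain k :: nat where k: "max (- 2 * ln (Y t2)) (ln (max 1 U)) + 2 * pi < real k"
    using reals_Archimedean2 by blast
  have k': "real k \<le> 2 * pi * k" using pi_ge_two by (simp add: mult_le_cancel_right1)
  define h where "h t = Y t - exp (- (X t + 2 * pi * k) / 2)" for t
  have "exp (- (X t2 + 2 * pi * k) / 2) < exp (ln (Y t2))"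
    using k k' Xb[of t2] t2 by (subst exp_less_cancel_iff) (auto simp: abs_le_iff)
  then have h2: "0 < h t2" using Ypos by (simp add: h_def)
  have "\<forall>\<^sub>F t in at_left 1. exp (- exp (- (2 * pi + 2 * pi * k) / 2)) < norm (\<Gamma> t)"
    using \<Gamma> unfolding boundary_path_def by (auto intro: order_tendstoD(1))
  from eventually_at_left_1_obtain[OF this] obtain t4 where t4: "0 \<le> t4" "t4 < 1"
    "\<And>t. t4 < t \<Longrightarrow> t < 1 \<Longrightarrow> exp (- exp (- (2 * pi + 2 * pi * k) / 2)) < norm (\<Gamma> t)" by blast
  obtain t3 where t3: "max t4 t2 < t3" "t3 < 1" using dense[of "max t4 t2" 1] t4 t2 by auto
  \<comment> \<open>The right side is the lowest height of the turn over all angles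
    \<open>X \<le> 2 * pi\<close>.\<close>
  have "Y t3 < exp (- (2 * pi + 2 * pi * k) / 2)"
    using t4(3)[of t3] Yeq[of t3] t3 by simp
  also have "\<dots> \<le> exp (- (X t3 + 2 * pi * k) / 2)"
    using Xb[of t3] t3 by (subst exp_le_cancel_iff) (auto simp: abs_le_iff)
  finally have h3: "h t3 < 0" by (simp add: h_def)
  have "continuous_on {t2..t3} h"
    unfolding h_def X_def Y_def
    by (intro continuous_intros continuous_on_subset[OF wc]) (use t3 in auto)
  then obtain t where t: "t2 \<le> t" "t \<le> t3" "h t = 0"
    using IVT2'[of h t3 0 t2] h2 h3 t3 by (auto simp: less_imp_le)
  define u where "u = exp (X t + 2 * pi * k)"
  have t1': "t < 1" using t t3 by simp
  have "u = (exp ((X t + 2 * pi * k) / 2))\<^sup>2"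
    by (simp add: u_def power2_eq_square flip: exp_add)
  then have "1 / sqrt u = exp (- ((X t + 2 * pi * k) / 2))"
    by (simp add: exp_minus inverse_eq_divide)
  also have "\<dots> = Y t" using t by (simp add: h_def minus_divide_left)
  finally have Yt: "1 / sqrt u = Y t" .
  have "spiral (of_real u) = exp (\<i> * (X t + 2 * pi * k) - Y t)"
    using spiral_of_real[of u] unfolding Yt[symmetric] by (simp add: u_def)
  also have "\<dots> = exp ((\<i> * X t - Y t) + 2 * of_nat k * pi * \<i>)"
    by (simp add: algebra_simps)
  also have "\<dots> = \<Gamma> t"
    using \<Gamma>eq[OF t(1) t1'] by (simp add: exp_add exp_two_pi_i' mult_ac flip: exp_of_nat_mult)
  finally have "\<Gamma> t = spiral (of_real u)" by simp
  moreover have "U < u"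
  proof -
    have "ln (max 1 U) < X t + 2 * pi * k" 
      using k k' Xb[OF t(1) t1'] max.cobounded2[of "ln (max 1 U)" "- 2 * ln (Y t2)"] by linarith
    then have "max 1 U < u" unfolding u_def using exp_less_mono[of "ln (max 1 U)"] by fastforce
    then show ?thesis by simp
  qed
  ultimately show ?thesis using that[of t u] t t2 t1' by (simp add: u_def)
qed

section \<open>Singular values and asymptotic paths of the tract function\<close>

locale tract_bound =
  fixes B :: real
  assumes near: "s \<in> half_strip 20000 (5 * pi / 6) \<Longrightarrow> norm (tract_function (spiral s) - exp (exp s)) \<le> B"
    and far: "norm z < 1 \<Longrightarrow> z \<notin> spiral ` half_strip 20000 (5 * pi / 6) \<Longrightarrow> norm (tract_function z) \<le> B"
begin

text \<open>One \<open>B\<close> is lost in passing to \<open>exp (exp s)\<close>, leaving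
  \<open>4 * B\<close> to beat a derivative bound \<open>2 * B\<close>. The term
  \<open>exp (exp 20001)\<close> forces the parameter into the inner strip, and the \<open>4\<close>
  helps keep the threshold above \<open>2 * (B + 1)\<close>.\<close>

definition "threshold = 5 * B + 4 + exp (exp 20001)"

lemma outer_strip_subset: "half_strip 20000 (5 * pi / 6) \<subseteq> spiral_dom"
  using pi_approx by (intro half_strip_mono) auto

lemma inner_strip_subset: "half_strip 20001 (pi / 2) \<subseteq> half_strip 20000 (5 * pi / 6)"
  by (intro half_strip_mono) auto

lemma B_nonneg: "0 \<le> B"
proof -
  have "(20001::complex) \<in> half_strip 20000 (5 * pi / 6)" by (simp add: half_strip_def)
  from order_trans[OF norm_ge_zero near[OF this]] show ?thesis .
qed

text \<open>A modulus above \<open>exp (exp 20001)\<close> requires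
  \<open>exp (Re s) * cos (Im s) > exp 20001\<close>, so the cosine is positive and
  \<open>Re s > 20001\<close>. The margins to the strip of \<open>near\<close> exceed
  \<open>1/2\<close>, leaving room for Cauchy estimates.\<close>

lemma large_value_in_tract:
  assumes "norm z < 1" "threshold < norm (tract_function z)"
  obtains s where "s \<in> half_strip 20001 (pi / 2)" "z = spiral s" "4 * B < norm (exp (exp s))"
proof -
  have "B < norm (tract_function z)"
    using assms(2) B_nonneg exp_gt_zero[of "exp 20001::real"] unfolding threshold_def by linarith
  then obtain s where s: "s \<in> half_strip 20000 (5 * pi / 6)" "z = spiral s"
    using far assms(1) by fastforce
  have "norm (tract_function z) \<le> norm (exp (exp s)) + B"
    using near[OF s(1)] norm_triangle_ineq[of "exp (exp s)" "tract_function z - exp (exp s)"] s(2) by simp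
  then have g: "4 * B + exp (exp 20001) < norm (exp (exp s))"
    using assms(2) unfolding threshold_def by linarith
  then have "exp (exp 20001) < exp (exp (Re s) * cos (Im s))"
    using B_nonneg unfolding norm_exp_exp by linarith
  then have c: "exp 20001 < exp (Re s) * cos (Im s)" by simp
  also have "\<dots> \<le> exp (Re s)" using mult_left_mono[OF cos_le_one, of "exp (Re s)"] by simp
  finally have "20001 < Re s" by simp
  moreover have "0 < exp (Re s) * cos (Im s)" using c exp_gt_zero[of "20001::real"] by linarith
  then have "0 < cos \<bar>Im s\<bar>" by (simp add: zero_less_mult_iff)
  then have "\<bar>Im s\<bar> < pi / 2"
    using cos_monotone_0_pi_le[of "pi / 2" "\<bar>Im s\<bar>"] s(1) by (force simp: half_strip_def)
  moreover have "4 * B < norm (exp (exp s))"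
    using g exp_gt_zero[of "exp 20001::real"] by linarith
  ultimately show ?thesis
    using that[of s] s(2) by (simp add: half_strip_def)
qed

text \<open>The error \<open>h\<close> is bounded by \<open>B\<close> on a disc of radius
  \<open>1/2\<close>, so its derivative is at most \<open>2 * B\<close>. At a critical point that
  derivative would be \<open>- exp (exp s) * exp s\<close>, of modulus above
  \<open>4 * B\<close>.\<close>

lemma deriv_nonzero_of_large_value:
  assumes z: "norm z < 1" "threshold < norm (tract_function z)"
  shows "deriv tract_function z \<noteq> 0"
proof
  assume d0: "deriv tract_function z = 0"
  obtain s where s: "s \<in> half_strip 20001 (pi / 2)" "z = spiral s" "4 * B < norm (exp (exp s))"
    using large_value_in_tract[OF z] by blast
  define h where "h w = tract_function (spiral w) - exp (exp w)" for w
  have sub: "cball s (1/2) \<subseteq> half_strip 20000 (5 * pi / 6)"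
    using s(1) pi_approx by (intro cball_half_strip) (auto simp: half_strip_def)
  have sd: "s \<in> spiral_dom" using s(1) inner_strip_subset outer_strip_subset by blast
  have "h holomorphic_on spiral_dom"
    unfolding h_def
    by (intro holomorphic_intros holomorphic_on_compose_gen[OF spiral_holomorphic tract_function_holomorphic, unfolded o_def])
       (use spiral_in_disc in auto)
  then have hol: "h holomorphic_on cball s (1/2)"
    using sub outer_strip_subset holomorphic_on_subset by blast
  have "norm ((deriv ^^ 1) h s) \<le> fact 1 * B / (1/2) ^ 1"
  proof (rule Cauchy_inequality)
    show "h holomorphic_on ball s (1/2)" using hol by (rule holomorphic_on_subset) auto
    show "continuous_on (cball s (1/2)) h" using hol by (rule holomorphic_on_imp_continuous_on)
    fix x assume "norm (s - x) = 1/2"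
    then have "x \<in> cball s (1/2)" by (simp add: dist_norm)
    then show "norm (h x) \<le> B" using near sub by (auto simp: h_def)
  qed simp
  then have "norm (deriv h s) \<le> 2 * B" by simp
  moreover have "(h has_field_derivative deriv tract_function z * deriv spiral s - exp (exp s) * exp s) (at s)"
  proof -
    have "(tract_function has_field_derivative deriv tract_function z) (at (spiral s))"
      using holomorphic_derivI[OF tract_function_holomorphic, of z] z s(2) by simp
    moreover have "(spiral has_field_derivative deriv spiral s) (at s)"
      using holomorphic_derivI[OF spiral_holomorphic open_half_strip sd] .
    ultimately show ?thesis
      unfolding h_def by (auto intro!: derivative_eq_intros DERIV_chain2[of tract_function])
  qed
  then have "deriv h s = - (exp (exp s) * exp s)" using d0 by (simp add: DERIV_imp_deriv)
  then have "norm (deriv h s) = norm (exp (exp s)) * exp (Re s)" by (simp add: norm_mult)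
  moreover have "norm (exp (exp s)) * 1 \<le> norm (exp (exp s)) * exp (Re s)"
    using s(1) by (intro mult_left_mono) (auto simp: half_strip_def)
  ultimately show False using s(3) B_nonneg by linarith
qed

text \<open>The inverse of the injective map \<open>spiral\<close> is holomorphic, so the path lifts
  continuously. The lift escapes because \<open>norm (spiral s)\<close> stays away from
  \<open>1\<close> on bounded parts of the strip.\<close>

lemma lift_of_large_path:
  assumes \<Gamma>: "boundary_path \<Gamma>" and large: "\<forall>\<^sub>F t in at_left 1. threshold < norm (tract_function (\<Gamma> t))"
  obtains t0 \<sigma> where "0 \<le> t0" "t0 < 1" "continuous_on {t0<..<1} \<sigma>"
    "\<And>t. t0 < t \<Longrightarrow> t < 1 \<Longrightarrow> \<sigma> t \<in> half_strip 20001 (pi / 2) \<and> \<Gamma> t = spiral (\<sigma> t)"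
    "filterlim (\<lambda>t. Re (\<sigma> t)) at_top (at_left 1)"
proof -
  obtain g where g: "g holomorphic_on (spiral ` spiral_dom)" "\<And>s. s \<in> spiral_dom \<Longrightarrow> g (spiral s) = s"
    using holomorphic_has_inverse[OF spiral_holomorphic open_half_strip spiral_inj] by metis
  obtain t0 where t0: "0 \<le> t0" "t0 < 1" "\<And>t. t0 < t \<Longrightarrow> t < 1 \<Longrightarrow> threshold < norm (tract_function (\<Gamma> t))"
    using eventually_at_left_1_obtain[OF large] by blast
  define \<sigma> where "\<sigma> t = g (\<Gamma> t)" for t
  have \<sigma>: "\<sigma> t \<in> half_strip 20001 (pi / 2) \<and> \<Gamma> t = spiral (\<sigma> t)" if "t0 < t" "t < 1" for t
  proof -
    have "norm (\<Gamma> t) < 1" using boundary_path_norm_less[OF \<Gamma>] that t0 by simp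
    from large_value_in_tract[OF this t0(3)[OF that]]
    obtain s where "s \<in> half_strip 20001 (pi / 2)" "\<Gamma> t = spiral s" by metis
    moreover have "s \<in> spiral_dom"
      using calculation inner_strip_subset outer_strip_subset by blast
    ultimately show ?thesis using g(2) by (simp add: \<sigma>_def)
  qed
  have dom: "\<sigma> t \<in> spiral_dom" if "t0 < t" "t < 1" for t
    using \<sigma>[OF that] inner_strip_subset outer_strip_subset by blast
  have \<Gamma>c: "continuous_on {0..<1} \<Gamma>" using \<Gamma> by (simp add: boundary_path_def)
  have cont: "continuous_on {t0<..<1} \<sigma>"
    unfolding \<sigma>_def
  proof (rule continuous_on_compose2[OF holomorphic_on_imp_continuous_on[OF g(1)]])
    show "continuous_on {t0<..<1} \<Gamma>" using \<Gamma>c by (rule continuous_on_subset) (use t0 in auto)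
    show "\<Gamma> ` {t0<..<1} \<subseteq> spiral ` spiral_dom" using \<sigma> dom by force
  qed
  have "filterlim (\<lambda>t. Re (\<sigma> t)) at_top (at_left 1)"
    unfolding filterlim_at_top
  proof
    fix K :: real
    \<comment> \<open>A bound for \<open>norm (spiral s)\<close> when
      \<open>norm s \<le> max 0 K + 2\<close>; the \<open>2\<close> accounts for an imaginary part
      below \<open>pi / 2\<close>.\<close>
    define c where "c = exp (- (4/5 * (1 / sqrt (max 0 K + 2))))"
    have "c < 1" by (simp add: c_def)
    then have "\<forall>\<^sub>F t in at_left 1. c < norm (\<Gamma> t)"
      using \<Gamma> unfolding boundary_path_def by (auto dest: order_tendstoD)
    moreover have "\<forall>\<^sub>F t in at_left 1. t \<in> {t0<..<1}"
      by (rule eventually_at_left_real) (rule t0)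
    ultimately show "\<forall>\<^sub>F t in at_left 1. K \<le> Re (\<sigma> t)"
    proof eventually_elim
      case (elim t)
      then have t: "t0 < t" "t < 1" by auto
      note d = dom[OF t]
      show ?case
      proof (rule ccontr)
        assume "\<not> K \<le> Re (\<sigma> t)"
        then have "norm (\<sigma> t) \<le> max 0 K + 2"
          using cmod_le[of "\<sigma> t"] \<sigma>[OF t] pi_less_4 by (auto simp: half_strip_def)
        then have "1 / sqrt (max 0 K + 2) \<le> 1 / sqrt (norm (\<sigma> t))"
          using spiral_dom_nonzero[OF d] by (intro frac_le) auto
        then have "4/5 * (1 / sqrt (max 0 K + 2)) \<le> Im (spiral_exponent (\<sigma> t))"
          using Im_spiral_exponent_bounds(1)[OF d] by linarith
        then have "norm (\<Gamma> t) \<le> c"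
          using \<sigma>[OF t] by (simp add: norm_spiral c_def)
        with elim show False by simp
      qed
    qed
  qed
  with t0 cont \<sigma> show ?thesis by (intro that) auto
qed

text \<open>Along such a path \<open>exp (exp (\<sigma> t))\<close> stays within
  \<open>norm a / 2\<close> of \<open>a\<close>, a disc that omits \<open>0\<close>. So
  \<open>exp (\<sigma> t)\<close> remains in one bounded branch of its logarithm, while the real
  part of the lift must tend to infinity.\<close>

lemma no_large_finite_asymptotic_value:
  assumes \<Gamma>: "boundary_path \<Gamma>" and lim: "((\<lambda>t. tract_function (\<Gamma> t)) \<longlongrightarrow> a) (at_left 1)"
  shows "norm a \<le> threshold"
proof (rule ccontr)
  assume "\<not> norm a \<le> threshold"
  then have a: "threshold < norm a" by simp
  have "\<forall>\<^sub>F t in at_left 1. threshold < norm (tract_function (\<Gamma> t))"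
    using tendsto_norm[OF lim] a by (rule order_tendstoD)
  from lift_of_large_path[OF \<Gamma> this] obtain t0 \<sigma> where \<sigma>: "0 \<le> t0" "t0 < 1" "continuous_on {t0<..<1} \<sigma>"
    "\<And>t. t0 < t \<Longrightarrow> t < 1 \<Longrightarrow> \<sigma> t \<in> half_strip 20001 (pi / 2) \<and> \<Gamma> t = spiral (\<sigma> t)"
    "filterlim (\<lambda>t. Re (\<sigma> t)) at_top (at_left 1)" by blast
  have "\<forall>\<^sub>F t in at_left 1. dist (tract_function (\<Gamma> t)) a < 1"
    using lim by (rule tendstoD) simp
  from eventually_at_left_1_obtain[OF this] obtain t1 where t1: "0 \<le> t1" "t1 < 1"
    "\<And>t. t1 < t \<Longrightarrow> t < 1 \<Longrightarrow> dist (tract_function (\<Gamma> t)) a < 1" by blast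
  define I where "I = {max t0 t1<..<1}"
  define v where "v t = exp (exp (\<sigma> t)) / a" for t
  have "5 * B + 4 < threshold" by (simp add: threshold_def)
  then have "2 * (B + 1) < norm a" using a B_nonneg by argo
  then have a0: "a \<noteq> 0" "2 * (B + 1) < norm a" using B_nonneg by auto
  have v: "norm (1 - v t) < 1/2" if "t \<in> I" for t
  proof -
    have t: "t0 < t" "t1 < t" "t < 1" using that by (auto simp: I_def)
    have "norm (tract_function (\<Gamma> t) - exp (exp (\<sigma> t))) \<le> B"
      using \<sigma>(4)[OF t(1,3)] near inner_strip_subset by auto
    then have "norm (a - exp (exp (\<sigma> t))) < B + 1"
      using t1(3)[OF t(2,3)] norm_triangle_ineq[of "a - tract_function (\<Gamma> t)" "tract_function (\<Gamma> t) - exp (exp (\<sigma> t))"]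
      by (simp add: dist_norm norm_minus_commute)
    moreover have "1 - v t = (a - exp (exp (\<sigma> t))) / a" using a0 by (simp add: v_def field_simps)
    then have "norm (1 - v t) = norm (a - exp (exp (\<sigma> t))) / norm a" by (simp add: norm_divide)
    ultimately show ?thesis using a0 by (simp add: pos_divide_less_eq)
  qed
  have vRe: "0 < Re (v t)" if "t \<in> I" for t
    using v[OF that] abs_Re_le_cmod[of "1 - v t"] by simp
  then have slit: "v t \<notin> \<real>\<^sub>\<le>\<^sub>0" "v t \<noteq> 0" if "t \<in> I" for t
    using that vRe[OF that] complex_nonpos_Reals_iff[of "v t"] by fastforce+
  have \<sigma>c: "continuous_on I \<sigma>" using \<sigma>(3) by (rule continuous_on_subset) (auto simp: I_def)
  \<comment> \<open>A continuous logarithm of the constant \<open>a\<close>: it pins \<open>exp (\<sigma> t)\<close> to one component of the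
    preimage under \<open>exp\<close> of the disc about \<open>a\<close> of radius \<open>norm a / 2\<close>.\<close>
  define q where "q t = exp (\<sigma> t) - Ln (v t)" for t
  have vc: "continuous_on I v" unfolding v_def by (intro continuous_intros \<sigma>c) (use a0 in auto)
  have "continuous_on I q"
    unfolding q_def by (intro continuous_intros \<sigma>c vc) (use slit in auto)
  moreover have expq: "exp (q t) = a" if "t \<in> I" for t
    using slit(2)[OF that] a0 by (simp add: q_def exp_diff v_def)
  moreover have "connected I" by (simp add: I_def)
  ultimately have "q constant_on I"
  proof (intro continuous_discrete_range_constant)
    fix t assume t: "t \<in> I"
    show "\<exists>e>0. \<forall>y. y \<in> I \<and> q y \<noteq> q t \<longrightarrow> e \<le> norm (q y - q t)"
    proof (intro exI[of _ "2 * pi"] conjI allI impI)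
      fix y assume y: "y \<in> I \<and> q y \<noteq> q t"
      then have "exp (q y) = exp (q t)" using expq t by simp
      then show "2 * pi \<le> norm (q y - q t)"
        using y exp_complex_eqI[of "q y" "q t"] abs_Im_le_cmod[of "q y - q t"] by fastforce
    qed simp
  qed
  then obtain c where c: "\<And>t. t \<in> I \<Longrightarrow> q t = c" by (auto simp: constant_on_def)
  \<comment> \<open>Constancy of \<open>q\<close> bounds the imaginary part of
    \<open>exp (\<sigma> t)\<close>. Its real part is nonnegative since
    \<open>\<bar>Im (\<sigma> t)\<bar> < pi / 2\<close>, and bounded above through
    \<open>norm (v t) \<le> 2\<close>.\<close>
  have bound: "Re (\<sigma> t) \<le> norm c + pi + norm (ln (2 * norm a))" if "t \<in> I" for t
  proof -
    have "exp (\<sigma> t) = c + Ln (v t)" using c[OF that] by (simp add: q_def algebra_simps)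
    then have "\<bar>Im (exp (\<sigma> t))\<bar> \<le> norm c + pi"
      using abs_Im_le_cmod[of c] mpi_less_Im_Ln[OF slit(2)[OF that]] Im_Ln_le_pi[OF slit(2)[OF that]] by simp
    moreover have "0 \<le> Re (exp (\<sigma> t))"
      using \<sigma>(4)[of t] that cos_ge_zero[of "Im (\<sigma> t)"] by (auto simp: I_def half_strip_def Re_exp abs_less_iff)
    moreover have "Re (exp (\<sigma> t)) \<le> ln (2 * norm a)"
    proof -
      have "norm (v t) \<le> 2" using v[OF that] norm_triangle_ineq2[of "v t" 1] by (simp add: norm_minus_commute)
      then have "exp (Re (exp (\<sigma> t))) \<le> 2 * norm a" using a0 by (simp add: v_def norm_divide field_simps)
      then show ?thesis using a0 by (simp add: ln_ge_iff)
    qed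
    ultimately have "norm (exp (\<sigma> t)) \<le> norm c + pi + norm (ln (2 * norm a))"
      using cmod_le[of "exp (\<sigma> t)"] by simp
    moreover have "Re (\<sigma> t) \<le> exp (Re (\<sigma> t))" using exp_ge_add_one_self[of "Re (\<sigma> t)"] by linarith
    ultimately show ?thesis by simp
  qed
  have "\<forall>\<^sub>F t in at_left 1. norm c + pi + norm (ln (2 * norm a)) < Re (\<sigma> t)"
    using \<sigma>(5) by (rule filterlim_at_top_dense[THEN iffD1, rule_format])
  moreover have "\<forall>\<^sub>F t in at_left 1. t \<in> I"
    unfolding I_def by (rule eventually_at_left_real) (use \<sigma> t1 in simp)
  ultimately have "\<forall>\<^sub>F t in at_left (1::real). False"
    by eventually_elim (use bound in fastforce)
  then show False by simp
qed

lemma no_asymptotic_value_at: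
  "\<not> asymptotic_value_at tract_function a \<zeta>"
proof
  assume "asymptotic_value_at tract_function a \<zeta>"
  then obtain \<Gamma> where \<Gamma>: "boundary_path \<Gamma>" "path_end \<Gamma> = {\<zeta>}"
    and lim: "limitin riemann_sphere (\<lambda>t. Some (tract_function (\<Gamma> t))) a (at_left 1)"
    by (auto simp: asymptotic_value_at_def asymptotic_along_def)
  note \<zeta> = boundary_path_converges[OF \<Gamma>]
  show False
  proof (cases a)
    case (Some b)
    then have "((\<lambda>t. tract_function (\<Gamma> t)) \<longlongrightarrow> b) (at_left 1)"
      using lim by (simp add: limitin_riemann_sphere_Some)
    then have "\<forall>\<^sub>F t in at_left 1. dist (tract_function (\<Gamma> t)) b < 1"
      by (rule tendstoD) simp
    from eventually_at_left_1_obtain[OF this] obtain t1 where t1: "0 \<le> t1" "t1 < 1"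
      "\<And>t. t1 < t \<Longrightarrow> t < 1 \<Longrightarrow> dist (tract_function (\<Gamma> t)) b < 1" by blast
    \<comment> \<open>At such a crossing the function has modulus at least
      \<open>exp (exp u) - B\<close>, which is too large for a value within \<open>1\<close> of
      \<open>b\<close>.\<close>
    obtain t u where tu: "t1 < t" "t < 1" "max 20000 (norm b + B + 1) < u" "\<Gamma> t = spiral (of_real u)"
      using path_crosses_spiral[OF \<Gamma>(1) \<zeta> t1(1,2)] by metis
    have "of_real u \<in> half_strip 20000 (5 * pi / 6)" using tu by (simp add: half_strip_def)
    from near[OF this] have "norm (exp (exp (complex_of_real u))) \<le> norm (tract_function (\<Gamma> t)) + B"
      using norm_triangle_ineq2[of "exp (exp (complex_of_real u))" "tract_function (\<Gamma> t)"] tu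
      by (simp add: norm_minus_commute)
    also have "norm (tract_function (\<Gamma> t)) \<le> norm b + 1"
      using t1(3)[OF tu(1,2)] norm_triangle_ineq2[of "tract_function (\<Gamma> t)" b] by (simp add: dist_norm)
    finally have "exp (exp u) \<le> norm b + 1 + B" unfolding norm_exp_exp by simp
    moreover have "u < exp (exp u)"
      using exp_ge_add_one_self[of u] exp_ge_add_one_self[of "exp u"] by linarith
    ultimately show False using tu by simp
  next
    case None
    then have inf: "filterlim (\<lambda>t. tract_function (\<Gamma> t)) at_infinity (at_left 1)"
      using lim by (simp add: limitin_riemann_sphere_None)
    have "\<forall>\<^sub>F t in at_left 1. threshold < norm (tract_function (\<Gamma> t))"
      using filterlim_at_infinity_imp_norm_at_top[OF inf] by (simp add: filterlim_at_top_dense)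
    from lift_of_large_path[OF \<Gamma>(1) this] obtain t0 \<sigma> where \<sigma>: "0 \<le> t0" "t0 < 1" "continuous_on {t0<..<1} \<sigma>"
      "\<And>t. t0 < t \<Longrightarrow> t < 1 \<Longrightarrow> \<sigma> t \<in> half_strip 20001 (pi / 2) \<and> \<Gamma> t = spiral (\<sigma> t)"
      "filterlim (\<lambda>t. Re (\<sigma> t)) at_top (at_left 1)" by blast
    have dom: "\<sigma> t \<in> spiral_dom" if "t0 < t" "t < 1" for t
      using \<sigma>(4)[OF that] inner_strip_subset outer_strip_subset by blast
    have "\<forall>\<^sub>F t in at_left 1. dist (\<Gamma> t) \<zeta> < 1"
      using \<zeta>(2) by (rule tendstoD) simp
    from eventually_at_left_1_obtain[OF this] obtain t1 where t1: "0 \<le> t1" "t1 < 1"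
      "\<And>t. t1 < t \<Longrightarrow> t < 1 \<Longrightarrow> dist (\<Gamma> t) \<zeta> < 1" by blast
    obtain t2 where t2: "max t0 t1 < t2" "t2 < 1" using dense[of "max t0 t1" 1] \<sigma>(2) t1 by auto
    define \<theta> where "\<theta> t = Re (spiral_exponent (\<sigma> t))" for t
    have \<theta>_ge: "ln (Re (\<sigma> t)) - 1 \<le> \<theta> t" if "t0 < t" "t < 1" for t
    proof -
      note d = dom[OF that]
      have "\<bar>Im (exp (- Ln (\<sigma> t) / 2))\<bar> \<le> 1/100"
        using abs_Im_le_cmod[of "exp (- Ln (\<sigma> t) / 2)"] inverse_sqrt_norm_le[OF d]
        unfolding norm_exp_half_Ln[OF spiral_dom_nonzero[OF d]] by linarith
      moreover have "ln (Re (\<sigma> t)) \<le> ln (norm (\<sigma> t))"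
        using d complex_Re_le_cmod[of "\<sigma> t"] by (intro ln_mono) (auto simp: half_strip_def)
      ultimately show ?thesis
        using spiral_dom_nonzero[OF d] by (simp add: \<theta>_def spiral_exponent_def)
    qed
    have \<theta>c: "continuous_on {t0<..<1} \<theta>"
      unfolding \<theta>_def
      by (intro continuous_intros continuous_on_compose2[OF spiral_exponent_continuous \<sigma>(3)]) (use dom in auto)
    obtain k :: nat where k: "\<theta> t2 \<le> real k" using real_arch_simple by blast
    \<comment> \<open>The angle opposite to \<open>\<zeta>\<close>, lifted by full turns beyond
      \<open>\<theta> t2\<close>. Where the lifted angle takes this value, the path is at distance
      \<open>1 + r\<close> from \<open>\<zeta>\<close>.\<close>
    define y where "y = Arg \<zeta> + pi + 2 * pi * k"
    have y: "\<theta> t2 \<le> y"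
    proof -
      have "real k \<le> 2 * pi * k" using pi_ge_two by (simp add: mult_le_cancel_right1)
      then show ?thesis using k mpi_less_Arg[of \<zeta>] by (simp add: y_def)
    qed
    have "\<forall>\<^sub>F t in at_left 1. exp (y + 1) \<le> Re (\<sigma> t)"
      using \<sigma>(5) by (simp add: filterlim_at_top)
    from eventually_at_left_1_obtain[OF this] obtain t4 where t4: "0 \<le> t4" "t4 < 1"
      "\<And>t. t4 < t \<Longrightarrow> t < 1 \<Longrightarrow> exp (y + 1) \<le> Re (\<sigma> t)" by blast
    obtain t3 where t3: "max t4 t2 < t3" "t3 < 1" using dense[of "max t4 t2" 1] t4 t2 by auto
    \<comment> \<open>The summand \<open>1\<close> compensates for the loss in
      \<open>\<theta>_ge\<close>.\<close>
    have "ln (exp (y + 1)) \<le> ln (Re (\<sigma> t3))"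
      using t4(3)[of t3] t3 by (intro ln_mono) (auto intro: less_le_trans[OF exp_gt_zero])
    then have y3: "y \<le> \<theta> t3" using \<theta>_ge[of t3] t2 t3 by simp
    have "continuous_on {t2..t3} \<theta>"
      using \<theta>c by (rule continuous_on_subset) (use t2 t3 in auto)
    then obtain t where t: "t2 \<le> t" "t \<le> t3" "\<theta> t = y"
      using IVT'[of \<theta> t2 y t3] y y3 t3 by auto
    have t': "t0 < t" "t1 < t" "t < 1" using t t2 t3 by auto
    define r where "r = exp (- Im (spiral_exponent (\<sigma> t)))"
    have "\<i> * spiral_exponent (\<sigma> t) = of_real (- Im (spiral_exponent (\<sigma> t))) + \<i> * Arg \<zeta> + \<i> * pi + 2 * of_nat k * pi * \<i>"
      using t(3) by (simp add: complex_eq_iff \<theta>_def y_def)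
    then have "exp (\<i> * spiral_exponent (\<sigma> t)) = exp (of_real (- Im (spiral_exponent (\<sigma> t)))) *
        exp (\<i> * Arg \<zeta>) * exp (\<i> * pi) * exp (2 * of_nat k * pi * \<i>)"
      by (simp only: exp_add)
    then have "\<Gamma> t = of_real r * exp (\<i> * Arg \<zeta>) * exp (\<i> * pi) * exp (2 * of_nat k * pi * \<i>)"
      using \<sigma>(4)[OF t'(1,3)] by (simp only: spiral_def r_def exp_of_real)
    also have "exp (\<i> * Arg \<zeta>) = \<zeta>"
      using Arg_eq[of \<zeta>] \<zeta>(1) norm_zero[where 'a = complex] by fastforce
    also have "exp (2 * of_nat k * pi * \<i>) = 1"
      using exp_integer_2pi[of "of_nat k"] by (simp add: mult_ac)
    finally have "\<Gamma> t - \<zeta> = - of_real (r + 1) * \<zeta>" by (simp add: algebra_simps)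
    then have "norm (\<Gamma> t - \<zeta>) = norm (complex_of_real (r + 1))"
      by (simp only: norm_mult norm_minus_cancel \<zeta>(1) mult_1_right)
    also have "\<dots> = r + 1" unfolding norm_of_real by (simp add: r_def)
    finally show False using t1(3)[OF t'(2,3)] by (simp add: dist_norm r_def not_less)
  qed
qed

lemma tract_function_not_constant: "\<not> tract_function constant_on unit_disc"
proof
  assume "tract_function constant_on unit_disc"
  then obtain c where c: "\<And>z. norm z < 1 \<Longrightarrow> tract_function z = c"
    by (auto simp: constant_on_def)
  define u where "u = max 20001 (norm c + B)"
  have u: "of_real u \<in> half_strip 20000 (5 * pi / 6)" by (simp add: half_strip_def u_def)
  then have "norm (c - exp (exp (complex_of_real u))) \<le> B"
    using near[OF u] c[of "spiral (of_real u)"] spiral_in_disc[of "of_real u"] outer_strip_subset by auto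
  then have "norm (exp (exp (complex_of_real u))) \<le> norm c + B"
    using norm_triangle_ineq2[of "exp (exp (complex_of_real u))" c] by (simp add: norm_minus_commute)
  then have "exp (exp u) \<le> norm c + B" unfolding norm_exp_exp by simp
  moreover have "u < exp (exp u)"
    using exp_ge_add_one_self[of u] exp_ge_add_one_self[of "exp u"] by linarith
  ultimately show False by (simp add: u_def)
qed

lemma tract_function_in_class: "tract_function \<in> eremenko_lyubich_disc"
proof -
  have "critical_values tract_function \<union> finite_asymptotic_values tract_function \<subseteq> cball 0 threshold"
  proof
    fix a assume "a \<in> critical_values tract_function \<union> finite_asymptotic_values tract_function"
    then consider z where "norm z < 1" "deriv tract_function z = 0" "a = tract_function z"
      | "asymptotic_value tract_function (Some a)"
      by (auto simp: critical_values_def finite_asymptotic_values_def)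
    then have "norm a \<le> threshold"
    proof cases
      case 1
      then show ?thesis using deriv_nonzero_of_large_value[of z] by (cases "norm a \<le> threshold") auto
    next
      case 2
      then show ?thesis
        using no_large_finite_asymptotic_value
        by (auto simp: asymptotic_value_def asymptotic_along_def limitin_riemann_sphere_Some)
    qed
    then show "a \<in> cball 0 threshold" by simp
  qed
  then have "bounded (critical_values tract_function \<union> finite_asymptotic_values tract_function)"
    using bounded_subset bounded_cball by blast
  then show ?thesis
    using tract_function_holomorphic tract_function_not_constant by (simp add: eremenko_lyubich_disc_def)
qed

end

theorem theorem4:
  shows "\<exists>f. f \<in> eremenko_lyubich_disc \<and> f \<notin> maclane_class"
proof -
  obtain B where B: "tract_bound B"
    using tract_function_bounds unfolding tract_bound_def by metis
  have "tract_function \<notin> maclane_class"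
  proof
    assume "tract_function \<in> maclane_class"
    then have "unit_circle \<subseteq> closure {\<zeta> \<in> unit_circle. \<exists>a. asymptotic_value_at tract_function a \<zeta>}"
      by (simp add: maclane_class_def)
    then have "unit_circle = {}"
      using tract_bound.no_asymptotic_value_at[OF B] by simp
    then show False by simp
  qed
  then show ?thesis using tract_bound.tract_function_in_class[OF B] by blast
qed

end
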